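(* The class $\mathscr{A}_\pi$ is properly contained in $\mathscr{C}_\pi$, and the class $\mathscr{N}_\pi$ is properly contained in $\mathscr{A}_\pi$; that is, $\mathscr{N}_\pi\subsetneq\mathscr{A}_\pi\subsetneq\mathscr{C}_\pi$.
   Context: All groups are finite. $\mathscr{N}_\pi$ (respectively $\mathscr{A}_\pi$, $\mathscr{C}_\pi$) is the class of finite groups $G$ such that any two nilpotent (respectively abelian, cyclic) subgroups of $G$ of equal prime power order are conjugate in $G$. *)

theory Defs
  imports
    "HOL-Computational_Algebra.Primes"
    "HOL-Algebra.Group_Action"
    "HOL-Algebra.Generated_Groups"
    "HOL-Algebra.Elementary_Groups"
begin

primrec lower_central_series :: "('a, 'b) monoid_scheme \<Rightarrow> nat \<Rightarrow> 'a set" where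
  "lower_central_series G 0 = carrier G"
| "lower_central_series G (Suc n) =
     generate G (\<Union>x \<in> lower_central_series G n. \<Union>y \<in> carrier G.
       {x \<otimes>\<^bsub>G\<^esub> y \<otimes>\<^bsub>G\<^esub> inv\<^bsub>G\<^esub> x \<otimes>\<^bsub>G\<^esub> inv\<^bsub>G\<^esub> y})"

definition nilpotent_group :: "('a, 'b) monoid_scheme \<Rightarrow> bool" where
  "nilpotent_group G \<longleftrightarrow> group G \<and> (\<exists>n. lower_central_series G n = {\<one>\<^bsub>G\<^esub>})"

definition conjugate_subgroups :: "('a, 'b) monoid_scheme \<Rightarrow> 'a set \<Rightarrow> 'a set \<Rightarrow> bool" where
  "conjugate_subgroups G H K \<longleftrightarrow>
     (\<exists>g \<in> carrier G. K = g <#\<^bsub>G\<^esub> H #>\<^bsub>G\<^esub> inv\<^bsub>G\<^esub> g)"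

text \<open>The finite groups with elements in \<open>'a\<close> in which any two subgroups of equal prime power
  order satisfying \<open>P\<close> are conjugate. The exponent 0 is harmless: the only subgroup of order 1
  is the trivial one. Over \<open>nat\<close> every finite group occurs up to isomorphism, so there
  proper inclusion of these sets means that some finite group separates the classes.\<close>

definition groups_with_conjugate :: "('a monoid \<Rightarrow> bool) \<Rightarrow> 'a monoid set" where
  "groups_with_conjugate P =
     {G. group G \<and> finite (carrier G) \<and>
         (\<forall>H K. subgroup H G \<and> subgroup K G \<and>
                P (G\<lparr>carrier := H\<rparr>) \<and> P (G\<lparr>carrier := K\<rparr>) \<and>
                card H = card K \<and> (\<exists>(p::nat) k. prime p \<and> card H = p ^ k)
            \<longrightarrow> conjugate_subgroups G H K)}"

definition N_pi :: "'a monoid set" where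
  "N_pi = groups_with_conjugate nilpotent_group"

definition A_pi :: "'a monoid set" where
  "A_pi = groups_with_conjugate comm_group"

definition C_pi :: "'a monoid set" where
  "C_pi = groups_with_conjugate cyclic_group"

end

theory Submission
  imports Defs "HOL-Algebra.Multiplicative_Group" "HOL-Library.Numeral_Type"
begin

text \<open>The inclusions hold because cyclic groups are abelian and abelian groups are nilpotent; the
  separating groups are \<open>SL(2,7)\<close> and \<open>PSL(2,7)\<close>.

  A nonscalar matrix \<open>x\<close> of determinant 1 and trace \<open>t\<close> is conjugate in \<open>SL(2,7)\<close> to the companion
  matrix of \<open>X\<^sup>2 - t X + 1\<close> as soon as the quadratic form \<open>v \<mapsto> det(v, x v)\<close> represents 1. Its
  discriminant is \<open>t\<^sup>2 - 4\<close>, so this holds for \<open>t \<noteq> \<plusminus>2\<close>, and for \<open>t = 2\<close> it holds after replacing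
  \<open>x\<close> by a power. As the powers of \<open>x\<close> are governed by \<open>t\<close>, cyclic subgroups of equal prime power order
  are conjugate in \<open>SL(2,7)\<close>, and those of equal order in \<open>PSL(2,7)\<close>. Centralizers of nonscalar elements of
  \<open>SL(2,7)\<close> are cyclic, hence so are all abelian subgroups, and \<open>SL(2,7)\<close> lies in the middle class. On
  the other hand, \<open>SL(2,7)\<close> contains the quaternion group next to a cyclic group of order 8, and
  \<open>PSL(2,7)\<close> contains its image, a Klein four-group, next to a cyclic group of order 4.\<close>

section \<open>Conjugate subgroups, nilpotency and isomorphisms\<close>

lemma (in group) pow_in_generate:
  "x \<in> carrier G \<Longrightarrow> x [^] (n::nat) \<in> generate G {x}"
  by (induction n) (auto intro: generate.intros)

lemma (in group) inv_cancel_left: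
  "\<lbrakk>g \<in> carrier G; z \<in> carrier G\<rbrakk> \<Longrightarrow> inv g \<otimes> (g \<otimes> z) = z"
  "\<lbrakk>g \<in> carrier G; z \<in> carrier G\<rbrakk> \<Longrightarrow> g \<otimes> (inv g \<otimes> z) = z"
  by (simp_all flip: m_assoc)

lemma conjugate_subgroups_iff_image:
  "conjugate_subgroups G H K \<longleftrightarrow>
    (\<exists>g\<in>carrier G. K = (\<lambda>h. g \<otimes>\<^bsub>G\<^esub> h \<otimes>\<^bsub>G\<^esub> inv\<^bsub>G\<^esub> g) ` H)"
proof -
  have "g <#\<^bsub>G\<^esub> H #>\<^bsub>G\<^esub> inv\<^bsub>G\<^esub> g = (\<lambda>h. g \<otimes>\<^bsub>G\<^esub> h \<otimes>\<^bsub>G\<^esub> inv\<^bsub>G\<^esub> g) ` H" for g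
    by (auto simp: l_coset_def r_coset_def)
  then show ?thesis by (simp add: conjugate_subgroups_def)
qed

lemma conjugate_subgroups_refl:
  assumes "group G" "H \<subseteq> carrier G"
  shows "conjugate_subgroups G H H"
proof -
  interpret group G by fact
  have "(\<lambda>h. \<one>\<^bsub>G\<^esub> \<otimes>\<^bsub>G\<^esub> h \<otimes>\<^bsub>G\<^esub> inv\<^bsub>G\<^esub> \<one>\<^bsub>G\<^esub>) ` H = (\<lambda>h. h) ` H"
    using assms(2) by (intro image_cong) auto
  then show ?thesis
    unfolding conjugate_subgroups_iff_image by (intro bexI[of _ "\<one>\<^bsub>G\<^esub>"]) auto
qed

lemma conjugate_subgroups_sym:
  assumes "group G" "H \<subseteq> carrier G" "conjugate_subgroups G H K"
  shows "conjugate_subgroups G K H"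
proof -
  interpret group G by fact
  obtain g where g: "g \<in> carrier G" and K: "K = (\<lambda>h. g \<otimes>\<^bsub>G\<^esub> h \<otimes>\<^bsub>G\<^esub> inv\<^bsub>G\<^esub> g) ` H"
    using assms(3) by (auto simp: conjugate_subgroups_iff_image)
  have "inv\<^bsub>G\<^esub> g \<otimes>\<^bsub>G\<^esub> (g \<otimes>\<^bsub>G\<^esub> h \<otimes>\<^bsub>G\<^esub> inv\<^bsub>G\<^esub> g) \<otimes>\<^bsub>G\<^esub> inv\<^bsub>G\<^esub> (inv\<^bsub>G\<^esub> g) = h" if "h \<in> H" for h
    using g that assms(2) by (simp add: m_assoc inv_cancel_left subset_iff)
  then have "(\<lambda>h. inv\<^bsub>G\<^esub> g \<otimes>\<^bsub>G\<^esub> h \<otimes>\<^bsub>G\<^esub> inv\<^bsub>G\<^esub> (inv\<^bsub>G\<^esub> g)) ` K = H"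
    by (simp add: K image_image)
  then show ?thesis
    unfolding conjugate_subgroups_iff_image using g by (intro bexI[of _ "inv\<^bsub>G\<^esub> g"]) auto
qed

lemma conjugate_subgroups_trans:
  assumes "group G" "H \<subseteq> carrier G" "conjugate_subgroups G H K" "conjugate_subgroups G K L"
  shows "conjugate_subgroups G H L"
proof -
  interpret group G by fact
  obtain g where g: "g \<in> carrier G" and K: "K = (\<lambda>h. g \<otimes>\<^bsub>G\<^esub> h \<otimes>\<^bsub>G\<^esub> inv\<^bsub>G\<^esub> g) ` H"
    using assms(3) by (auto simp: conjugate_subgroups_iff_image)
  obtain k where k: "k \<in> carrier G" and L: "L = (\<lambda>h. k \<otimes>\<^bsub>G\<^esub> h \<otimes>\<^bsub>G\<^esub> inv\<^bsub>G\<^esub> k) ` K"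
    using assms(4) by (auto simp: conjugate_subgroups_iff_image)
  have "k \<otimes>\<^bsub>G\<^esub> (g \<otimes>\<^bsub>G\<^esub> h \<otimes>\<^bsub>G\<^esub> inv\<^bsub>G\<^esub> g) \<otimes>\<^bsub>G\<^esub> inv\<^bsub>G\<^esub> k = k \<otimes>\<^bsub>G\<^esub> g \<otimes>\<^bsub>G\<^esub> h \<otimes>\<^bsub>G\<^esub> inv\<^bsub>G\<^esub> (k \<otimes>\<^bsub>G\<^esub> g)"
    if "h \<in> H" for h
    using g k that assms(2) by (simp add: m_assoc inv_mult_group subset_iff)
  then have "L = (\<lambda>h. (k \<otimes>\<^bsub>G\<^esub> g) \<otimes>\<^bsub>G\<^esub> h \<otimes>\<^bsub>G\<^esub> inv\<^bsub>G\<^esub> (k \<otimes>\<^bsub>G\<^esub> g)) ` H"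
    by (simp add: L K image_image)
  then show ?thesis
    unfolding conjugate_subgroups_iff_image using g k by blast
qed

lemma conjugate_subgroups_hom_image:
  assumes "group_hom G Q f" "H \<subseteq> carrier G" "conjugate_subgroups G H K"
  shows "conjugate_subgroups Q (f ` H) (f ` K)"
proof -
  interpret group_hom G Q f by fact
  obtain g where g: "g \<in> carrier G" and K: "K = (\<lambda>h. g \<otimes>\<^bsub>G\<^esub> h \<otimes>\<^bsub>G\<^esub> inv\<^bsub>G\<^esub> g) ` H"
    using assms(3) by (auto simp: conjugate_subgroups_iff_image)
  have "f ` K = (\<lambda>h. f g \<otimes>\<^bsub>Q\<^esub> h \<otimes>\<^bsub>Q\<^esub> inv\<^bsub>Q\<^esub> (f g)) ` (f ` H)"
    unfolding K image_image using g assms(2) by (intro image_cong) auto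
  with g show ?thesis
    unfolding conjugate_subgroups_iff_image by (intro bexI[of _ "f g"]) simp_all
qed

lemma (in group) conjugation_hom:
  assumes "g \<in> carrier G"
  shows "group_hom G G (\<lambda>h. g \<otimes> h \<otimes> inv g)"
proof unfold_locales
  show "(\<lambda>h. g \<otimes> h \<otimes> inv g) \<in> hom G G"
    using assms by (intro homI) (auto simp: m_assoc inv_cancel_left)
qed

section \<open>Cyclic subgroups and their conjugates\<close>

text \<open>Conjugation by \<open>g\<close> sends \<open>c\<close> to the \<open>k\<close>-th power
  of \<open>x\<close>, which generates the same subgroup as \<open>x\<close> because its
  \<open>m\<close>-th power is \<open>x\<close>. The exponent covers the case where only a suitable
  power of \<open>x\<close> is conjugate to \<open>c\<close>.\<close>

lemma conjugate_generateI:
  fixes k m :: nat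
  assumes "group G" and x: "x \<in> carrier G" and c: "c \<in> carrier G" and g: "g \<in> carrier G"
    and km: "(x [^]\<^bsub>G\<^esub> k) [^]\<^bsub>G\<^esub> m = x"
    and eq: "x [^]\<^bsub>G\<^esub> k \<otimes>\<^bsub>G\<^esub> g = g \<otimes>\<^bsub>G\<^esub> c"
  shows "conjugate_subgroups G (generate G {x}) (generate G {c})"
proof -
  interpret group G by fact
  let ?f = "\<lambda>h. g \<otimes>\<^bsub>G\<^esub> h \<otimes>\<^bsub>G\<^esub> inv\<^bsub>G\<^esub> g"
  have hom: "group_hom G G ?f" using g by (rule conjugation_hom)
  have "?f c = x [^]\<^bsub>G\<^esub> k"
    using x g c by (simp add: eq[symmetric] m_assoc)
  then have "?f ` generate G {c} = generate G {x [^]\<^bsub>G\<^esub> k}"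
    using group_hom.generate_img[OF hom, of "{c}"] c by simp
  also have "\<dots> = generate G {x}"
  proof (intro equalityI generate_subgroup_incl generate_is_subgroup)
    show "{x [^]\<^bsub>G\<^esub> k} \<subseteq> generate G {x}"
      using x by (simp add: pow_in_generate)
    show "{x} \<subseteq> generate G {x [^]\<^bsub>G\<^esub> k}"
      using pow_in_generate[of "x [^]\<^bsub>G\<^esub> k" m] x km by simp
  qed (use x in auto)
  finally have "generate G {x} = ?f ` generate G {c}" ..
  with g have "conjugate_subgroups G (generate G {c}) (generate G {x})"
    unfolding conjugate_subgroups_iff_image by (rule bexI[rotated])
  then show ?thesis
    using c generate_incl[of "{c}"] \<open>group G\<close> by (intro conjugate_subgroups_sym[of G "generate G {c}"]) auto
qed

text \<open>The exponent is \<open>ord y\<close> divided by \<open>card H\<close>. By Lagrange this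
  quotient divides the exponent of any power of \<open>y\<close> lying in \<open>H\<close>, so
  \<open>H\<close> is contained in the subgroup generated by \<open>y [^] n\<close>, which has the
  same size.\<close>

lemma (in group) subgroup_of_generate_singleton:
  assumes fin: "finite (carrier G)" and H: "subgroup H G" and y: "y \<in> carrier G"
    and sub: "H \<subseteq> generate G {y}"
  obtains n :: nat where "H = generate G {y [^] n}"
proof -
  define N :: nat where "N = ord y"
  have Hsub: "subgroup H (G\<lparr>carrier := generate G {y}\<rparr>)"
    using H sub y by (intro subgroup_incl generate_is_subgroup) auto
  have grp: "group (G\<lparr>carrier := generate G {y}\<rparr>)"
    using y by (intro subgroup.subgroup_is_group generate_is_subgroup) (auto intro: is_group)
  have "card H dvd N"
    using group.lagrange[OF grp Hsub] generate_pow_card[OF y]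
    by (simp add: order_def N_def) (metis dvd_triv_right)
  then obtain n where N: "N = card H * n" by blast
  have "N > 0" using ord_ge_1[OF fin y] by (simp add: N_def)
  have n: "n > 0" "card H > 0" using N \<open>N > 0\<close> by (auto intro: gr0I)
  have "ord (y [^] n) = card H"
    using ord_pow[OF y, of n] N n by (simp add: N_def mult.commute)
  then have card: "card (generate G {y [^] n}) = card H"
    using generate_pow_card y by simp
  have "h \<in> generate G {y [^] n}" if h: "h \<in> H" for h
  proof -
    obtain i :: nat where i: "h = y [^] i"
      using h sub generate_pow_on_finite_carrier[OF fin y] by blast
    interpret H: group "G\<lparr>carrier := H\<rparr>" using H is_group by (rule subgroup.subgroup_is_group)
    have "h [^] card H = \<one>"
      using H.pow_order_eq_1[of h] h n
      by (simp add: order_def nat_pow_consistent[symmetric])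
    then have "y [^] (i * card H) = \<one>"
      using i y by (simp add: nat_pow_pow)
    then have "N dvd i * card H"
      using pow_eq_id y N_def by blast
    then have "n dvd i" using n by (simp add: N mult.commute)
    then obtain j where "i = n * j" by blast
    then have "h = (y [^] n) [^] j"
      using i y by (simp add: nat_pow_pow)
    then show ?thesis
      using y by (simp add: pow_in_generate)
  qed
  then have "H = generate G {y [^] n}"
    using card finite_subset[OF generate_incl fin] y by (intro card_subset_eq) auto
  then show ?thesis ..
qed

section \<open>Nilpotency and transport along isomorphisms\<close>

text \<open>The first term of the lower central series lies in the central subgroup
  \<open>Z\<close>, so the second is trivial. This serves abelian groups and the quaternion group
  alike.\<close>

lemma nilpotent_groupI:
  assumes "group G" and Z: "subgroup Z G"
    and comm: "\<And>x y. \<lbrakk>x \<in> carrier G; y \<in> carrier G\<rbrakk> \<Longrightarrow>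
       x \<otimes>\<^bsub>G\<^esub> y \<otimes>\<^bsub>G\<^esub> inv\<^bsub>G\<^esub> x \<otimes>\<^bsub>G\<^esub> inv\<^bsub>G\<^esub> y \<in> Z"
    and central: "\<And>z y. \<lbrakk>z \<in> Z; y \<in> carrier G\<rbrakk> \<Longrightarrow> z \<otimes>\<^bsub>G\<^esub> y = y \<otimes>\<^bsub>G\<^esub> z"
  shows "nilpotent_group G"
proof -
  interpret group G by fact
  have 1: "lower_central_series G 1 \<subseteq> Z"
    using comm unfolding One_nat_def lower_central_series.simps
    by (intro generate_subgroup_incl[OF _ Z]) blast
  have "x \<otimes>\<^bsub>G\<^esub> y \<otimes>\<^bsub>G\<^esub> inv\<^bsub>G\<^esub> x \<otimes>\<^bsub>G\<^esub> inv\<^bsub>G\<^esub> y = \<one>\<^bsub>G\<^esub>"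
    if "x \<in> lower_central_series G 1" "y \<in> carrier G" for x y
  proof -
    have "x \<in> Z" using 1 that by blast
    then have "x \<in> carrier G" using subgroup.subset[OF Z] by blast
    then show ?thesis
      using that central[OF \<open>x \<in> Z\<close> that(2)] by (simp add: m_assoc inv_cancel_left)
  qed
  then have "(\<Union>x \<in> lower_central_series G 1. \<Union>y \<in> carrier G.
       {x \<otimes>\<^bsub>G\<^esub> y \<otimes>\<^bsub>G\<^esub> inv\<^bsub>G\<^esub> x \<otimes>\<^bsub>G\<^esub> inv\<^bsub>G\<^esub> y}) \<subseteq> {\<one>\<^bsub>G\<^esub>}"
    by blast
  from generate_subgroup_incl[OF this triv_subgroup]
  have "lower_central_series G 2 \<subseteq> {\<one>\<^bsub>G\<^esub>}"
    by (simp add: numeral_2_eq_2)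
  moreover have "\<one>\<^bsub>G\<^esub> \<in> lower_central_series G 2"
    by (simp add: numeral_2_eq_2 generate.one)
  ultimately show ?thesis
    using \<open>group G\<close> unfolding nilpotent_group_def by blast
qed

lemma comm_group_imp_nilpotent:
  assumes "comm_group G"
  shows "nilpotent_group G"
proof -
  interpret comm_group G by fact
  show ?thesis
    by (rule nilpotent_groupI[of G "carrier G"]) (auto intro: subgroup_self m_comm)
qed

text \<open>Homomorphisms preserve commutators and generated subgroups. The inclusion in
  \<open>carrier A\<close> is carried through the induction because both facts need elements of the
  carrier.\<close>

lemma lower_central_series_iso:
  assumes "group A" "group B" "f \<in> iso A B"
  shows "lower_central_series A n \<subseteq> carrier A \<and> lower_central_series B n = f ` lower_central_series A n"
proof (induction n)
  case 0
  show ?case using assms(3) by (auto simp: iso_def bij_betw_def)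
next
  case (Suc n)
  interpret group_hom A B f
    using assms by (auto simp: group_hom_def group_hom_axioms_def iso_def)
  let ?S = "\<Union>x \<in> lower_central_series A n. \<Union>y \<in> carrier A.
       {x \<otimes>\<^bsub>A\<^esub> y \<otimes>\<^bsub>A\<^esub> inv\<^bsub>A\<^esub> x \<otimes>\<^bsub>A\<^esub> inv\<^bsub>A\<^esub> y}"
  have S: "?S \<subseteq> carrier A" using Suc.IH by auto
  have surj: "carrier B = f ` carrier A" using assms(3) by (auto simp: iso_def bij_betw_def)
  have "(\<Union>x \<in> lower_central_series B n. \<Union>y \<in> carrier B.
       {x \<otimes>\<^bsub>B\<^esub> y \<otimes>\<^bsub>B\<^esub> inv\<^bsub>B\<^esub> x \<otimes>\<^bsub>B\<^esub> inv\<^bsub>B\<^esub> y}) = f ` ?S"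
  proof -
    have "f (x \<otimes>\<^bsub>A\<^esub> y \<otimes>\<^bsub>A\<^esub> inv\<^bsub>A\<^esub> x \<otimes>\<^bsub>A\<^esub> inv\<^bsub>A\<^esub> y) =
        f x \<otimes>\<^bsub>B\<^esub> f y \<otimes>\<^bsub>B\<^esub> inv\<^bsub>B\<^esub> (f x) \<otimes>\<^bsub>B\<^esub> inv\<^bsub>B\<^esub> (f y)"
      if "x \<in> lower_central_series A n" "y \<in> carrier A" for x y
      using that Suc.IH by (auto simp: subset_iff)
    then show ?thesis
      using Suc.IH by (simp add: surj image_UN cong: SUP_cong)
  qed
  then show ?case
    using generate_img[OF S] S G.generate_incl by simp
qed

lemma nilpotent_group_iso_image:
  assumes "group A" "group B" "f \<in> iso A B" "nilpotent_group A"
  shows "nilpotent_group B"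
proof -
  interpret group_hom A B f
    using assms by (auto simp: group_hom_def group_hom_axioms_def iso_def)
  show ?thesis
    using assms lower_central_series_iso[OF assms(1-3)] by (force simp: nilpotent_group_def)
qed

lemma iso_nilpotent_group:
  assumes "group A" "group B" "A \<cong> B"
  shows "nilpotent_group A \<longleftrightarrow> nilpotent_group B"
proof -
  obtain f where f: "f \<in> iso A B" using assms(3) by (auto simp: is_iso_def)
  show ?thesis
    using nilpotent_group_iso_image[OF assms(1,2) f]
      nilpotent_group_iso_image[OF assms(2,1) group.iso_set_sym[OF assms(1) f]] by blast
qed

lemma iso_comm_group:
  assumes "group A" "group B" "A \<cong> B"
  shows "comm_group A \<longleftrightarrow> comm_group B"
  using assms comm_group.iso_imp_comm_group[of A B] comm_group.iso_imp_comm_group[of B A]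
  by (auto simp: group.iso_sym group.is_monoid)

text \<open>Subgroups of \<open>H\<close> are pulled back along the inverse \<open>g\<close>,
  conjugated in \<open>G\<close> and pushed forward along \<open>f\<close>. Two predicates occur
  because the element types may differ.\<close>

lemma groups_with_conjugate_iso:
  assumes G: "G \<in> groups_with_conjugate P" and "group H" and f: "f \<in> iso G H"
    and P: "\<And>A B. \<lbrakk>group A; group B; A \<cong> B; P' B\<rbrakk> \<Longrightarrow> P A"
  shows "H \<in> groups_with_conjugate P'"
proof -
  have "group G" using G by (simp add: groups_with_conjugate_def)
  define g where "g = inv_into (carrier G) f"
  have bij: "bij_betw f (carrier G) (carrier H)" using f by (simp add: iso_def)
  have g: "g \<in> iso H G"
    using group.iso_set_sym[OF \<open>group G\<close> f] by (simp add: g_def)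
  interpret gh: group_hom H G g
    using \<open>group G\<close> \<open>group H\<close> g by (auto simp: group_hom_def group_hom_axioms_def iso_def)
  interpret fh: group_hom G H f
    using \<open>group G\<close> \<open>group H\<close> f by (auto simp: group_hom_def group_hom_axioms_def iso_def)
  have gbij: "bij_betw g (carrier H) (carrier G)" using g by (simp add: iso_def)
  have fg: "f ` (g ` K) = K" if "subgroup K H" for K
    using bij subgroup.subset[OF that]
    by (force simp: g_def image_image bij_betw_def f_inv_into_f subset_iff)
  have sub: "subgroup (g ` K) G" if "subgroup K H" for K
    using that by (rule gh.subgroup_img_is_subgroup)
  have P_img: "P (G\<lparr>carrier := g ` K\<rparr>)" if K: "subgroup K H" and "P' (H\<lparr>carrier := K\<rparr>)" for K
  proof (rule P[of _ "H\<lparr>carrier := K\<rparr>"])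
    show "G\<lparr>carrier := g ` K\<rparr> \<cong> H\<lparr>carrier := K\<rparr>"
    proof (rule is_isoI, rule isoI)
      show "f \<in> hom (G\<lparr>carrier := g ` K\<rparr>) (H\<lparr>carrier := K\<rparr>)"
        using fg[OF K] subgroup.subset[OF sub[OF K]] by (intro homI) (auto simp: subset_iff simp del: gh.hom_mult)
      show "bij_betw f (carrier (G\<lparr>carrier := g ` K\<rparr>)) (carrier (H\<lparr>carrier := K\<rparr>))"
        using fg[OF K] subgroup.subset[OF sub[OF K]] bij
        by (auto simp: bij_betw_def intro: inj_on_subset)
    qed
  qed (use that sub[OF K] \<open>group G\<close> \<open>group H\<close> in \<open>auto intro: subgroup.subgroup_is_group\<close>)
  have card: "card (g ` K) = card K" if "subgroup K H" for K
    using gbij subgroup.subset[OF that] by (auto simp: bij_betw_def intro: card_image inj_on_subset)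
  have "conjugate_subgroups H K L"
    if K: "subgroup K H" "P' (H\<lparr>carrier := K\<rparr>)" and L: "subgroup L H" "P' (H\<lparr>carrier := L\<rparr>)"
      and "card K = card L" "\<exists>(p::nat) k. prime p \<and> card K = p ^ k" for K L
  proof -
    have "conjugate_subgroups G (g ` K) (g ` L)"
      using G sub[OF K(1)] sub[OF L(1)] P_img[OF K] P_img[OF L] card[OF K(1)] card[OF L(1)] that(5,6)
      unfolding groups_with_conjugate_def by auto
    from conjugate_subgroups_hom_image[OF fh.group_hom_axioms _ this] show ?thesis
      using subgroup.subset[OF sub[OF K(1)]] by (simp add: fg K(1) L(1))
  qed
  moreover have "finite (carrier H)"
    using G bij by (auto simp: groups_with_conjugate_def bij_betw_finite)
  ultimately show ?thesis
    using \<open>group H\<close> unfolding groups_with_conjugate_def by blast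
qed

text \<open>The structure is moved along an injection into the naturals; this brings the matrix and
  coset groups below to the type \<open>nat\<close>.\<close>

lemma ex_nat_group_iso:
  assumes "group G" "finite (carrier G)"
  obtains N :: "nat monoid" and f where "group N" "f \<in> iso G N"
proof -
  interpret group G by fact
  obtain f :: "_ \<Rightarrow> nat" where inj: "inj_on f (carrier G)"
    using finite_imp_inj_to_nat_seg[OF assms(2)] by blast
  define g where "g = inv_into (carrier G) f"
  have g[simp]: "g (f x) = x" if "x \<in> carrier G" for x
    using inj that by (simp add: g_def)
  define N where "N = \<lparr>carrier = f ` carrier G, mult = \<lambda>x y. f (g x \<otimes>\<^bsub>G\<^esub> g y), one = f \<one>\<^bsub>G\<^esub>\<rparr>"
  have "group N"
  proof (rule groupI)
    fix x assume "x \<in> carrier N"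
    then obtain u where "u \<in> carrier G" "x = f u" by (auto simp: N_def)
    then show "\<exists>y\<in>carrier N. y \<otimes>\<^bsub>N\<^esub> x = \<one>\<^bsub>N\<^esub>"
      by (intro bexI[of _ "f (inv\<^bsub>G\<^esub> u)"]) (auto simp: N_def)
  qed (auto simp: N_def m_assoc)
  moreover have "f \<in> iso G N"
    using inj by (auto simp: iso_def hom_def N_def bij_betw_def)
  ultimately show ?thesis ..
qed

section \<open>The group SL(2) over a commutative ring\<close>

text \<open>The quadruple \<open>(a, b, c, d)\<close> stands for the matrix with rows
  \<open>(a, b)\<close> and \<open>(c, d)\<close>.\<close>

type_synonym 'a mat2 = "'a \<times> 'a \<times> 'a \<times> 'a"

fun mat2_mult :: "'a::comm_ring_1 mat2 \<Rightarrow> 'a mat2 \<Rightarrow> 'a mat2" where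
  "mat2_mult (a, b, c, d) (a', b', c', d') =
     (a * a' + b * c', a * b' + b * d', c * a' + d * c', c * b' + d * d')"

fun mat2_det :: "'a::comm_ring_1 mat2 \<Rightarrow> 'a" where
  "mat2_det (a, b, c, d) = a * d - b * c"

fun mat2_trace :: "'a::comm_ring_1 mat2 \<Rightarrow> 'a" where
  "mat2_trace (a, b, c, d) = a + d"

text \<open>The matrix \<open>r + s x\<close>, an element of the commutative ring generated by
  \<open>x\<close>.\<close>

fun affine :: "'a::comm_ring_1 \<Rightarrow> 'a \<Rightarrow> 'a mat2 \<Rightarrow> 'a mat2" where
  "affine r s (a, b, c, d) = (r + s * a, s * b, s * c, r + s * d)"

definition scalar :: "'a::comm_ring_1 mat2 \<Rightarrow> bool" where
  "scalar x \<longleftrightarrow> (\<exists>r. x = (r, 0, 0, r))"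

definition SL2 :: "'a::comm_ring_1 mat2 monoid" where
  "SL2 = \<lparr>carrier = {x. mat2_det x = 1}, mult = mat2_mult, one = (1, 0, 0, 1)\<rparr>"

lemma carrier_SL2: "x \<in> carrier SL2 \<longleftrightarrow> mat2_det x = 1"
  and mult_SL2: "x \<otimes>\<^bsub>SL2\<^esub> y = mat2_mult x y"
  and one_SL2: "\<one>\<^bsub>SL2\<^esub> = (1, 0, 0, 1)"
  by (simp_all add: SL2_def)

lemma mat2_det_mult: "mat2_det (mat2_mult x y) = mat2_det x * mat2_det y"
  by (cases x; cases y) (simp add: algebra_simps)

lemma group_SL2: "group (SL2 :: 'a::comm_ring_1 mat2 monoid)"
proof (rule groupI)
  fix x :: "'a mat2" assume "x \<in> carrier SL2"
  then show "\<exists>y\<in>carrier SL2. y \<otimes>\<^bsub>SL2\<^esub> x = \<one>\<^bsub>SL2\<^esub>"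
    \<comment> \<open>The left inverse is the adjugate, as the determinant is 1.\<close>
    by (cases x) (auto simp: carrier_SL2 mult_SL2 one_SL2 algebra_simps
      intro!: bexI[of _ "case x of (a, b, c, d) \<Rightarrow> (d, - b, - c, a)"])
next
  fix x y z :: "'a mat2"
  show "x \<otimes>\<^bsub>SL2\<^esub> y \<otimes>\<^bsub>SL2\<^esub> z = x \<otimes>\<^bsub>SL2\<^esub> (y \<otimes>\<^bsub>SL2\<^esub> z)"
    by (cases x; cases y; cases z) (simp add: mult_SL2 algebra_simps)
next
  fix x :: "'a mat2"
  show "\<one>\<^bsub>SL2\<^esub> \<otimes>\<^bsub>SL2\<^esub> x = x" by (cases x) (simp add: mult_SL2 one_SL2)
qed (auto simp: carrier_SL2 mult_SL2 one_SL2 mat2_det_mult)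

interpretation SL2: group "SL2 :: 'a::comm_ring_1 mat2 monoid"
  by (rule group_SL2)

section \<open>Powers and the companion matrix via Cayley-Hamilton\<close>

text \<open>The coefficients of the remainder \<open>r + s X\<close> of X^n modulo X^2 - t X + 1;
  the recursion multiplies by X.\<close>

fun pow_coeffs :: "'a::comm_ring_1 \<Rightarrow> nat \<Rightarrow> 'a \<times> 'a" where
  "pow_coeffs t 0 = (1, 0)"
| "pow_coeffs t (Suc n) = (case pow_coeffs t n of (r, s) \<Rightarrow> (- s, r + t * s))"

text \<open>By Cayley-Hamilton, \<open>x\<^sup>2 = t x - 1\<close> for a matrix of determinant 1 and trace \<open>t\<close>.\<close>

lemma SL2_pow:
  assumes "x \<in> carrier SL2"
  shows "x [^]\<^bsub>SL2\<^esub> n =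
    affine (fst (pow_coeffs (mat2_trace x) n)) (snd (pow_coeffs (mat2_trace x) n)) x"
proof (induction n)
  case 0
  then show ?case by (cases x) (simp add: one_SL2)
next
  case (Suc n)
  obtain a b c d where x: "x = (a, b, c, d)" by (cases x)
  have ad: "a * d = 1 + b * c" using assms by (simp add: carrier_SL2 x algebra_simps)
  have "a * (d * z) = z + b * (c * z)" for z
    using arg_cong[OF ad, of "\<lambda>y. y * z"] by (simp add: algebra_simps)
  from this[of "snd (pow_coeffs (a + d) n)"] show ?case
    using Suc by (simp add: mult_SL2 x algebra_simps case_prod_beta)
qed

lemma affine_comm: "mat2_mult (affine r s x) (affine r' s' x) = mat2_mult (affine r' s' x) (affine r s x)"
  by (cases x) (simp add: algebra_simps)

text \<open>This is the norm of \<open>r + s X\<close> in the ring where X^2 = t X - 1, with t the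
  trace.\<close>

lemma mat2_det_affine:
  assumes "mat2_det x = 1"
  shows "mat2_det (affine r s x) = r * r + r * s * mat2_trace x + s * s"
proof -
  obtain a b c d where x: "x = (a, b, c, d)" by (cases x)
  have ad: "a * d = 1 + b * c" using assms by (simp add: x algebra_simps)
  have "s * (s * (a * d)) = s * (s * (1 + b * c))" by (simp add: ad)
  then show ?thesis by (simp add: x algebra_simps)
qed

lemma mat2_trace_affine: "mat2_trace (affine r s x) = 2 * r + s * mat2_trace x"
  by (cases x) (simp add: algebra_simps)

text \<open>The determinant of the matrix with columns \<open>w = (u, v)\<close> and \<open>x w\<close>.\<close>

fun gen_form :: "'a::comm_ring_1 mat2 \<Rightarrow> 'a \<Rightarrow> 'a \<Rightarrow> 'a" where
  "gen_form (a, b, c, d) u v = c * (u * u) + (d - a) * (u * v) - b * (v * v)"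

text \<open>The multiple \<open>r w\<close> of the first column contributes nothing to the
  determinant of \<open>w\<close> and \<open>(r + s x) w\<close>.\<close>

lemma gen_form_affine: "gen_form (affine r s x) u v = s * gen_form x u v"
  by (cases x) (simp add: algebra_simps)

text \<open>In the basis \<open>w\<close>, \<open>x w\<close> the matrix \<open>x\<close> becomes
  the companion matrix, by Cayley-Hamilton. The hypothesis on \<open>gen_form\<close> gives this
  basis determinant 1, so the change of basis stays in \<open>SL2\<close>.\<close>

lemma SL2_companion:
  assumes "x \<in> carrier SL2" "gen_form x u v = 1"
  obtains g where "g \<in> carrier SL2" "x \<otimes>\<^bsub>SL2\<^esub> g = g \<otimes>\<^bsub>SL2\<^esub> (0, - 1, 1, mat2_trace x)"
proof -
  obtain a b c d where x: "x = (a, b, c, d)" by (cases x)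
  have ad: "a * d = 1 + b * c" using assms by (simp add: carrier_SL2 x algebra_simps)
  have "a * (d * z) = z + b * (c * z)" for z
    using arg_cong[OF ad, of "\<lambda>y. y * z"] by (simp add: algebra_simps)
  \<comment> \<open>The columns of the witness are \<open>w = (u, v)\<close> and
    \<open>x w\<close>.\<close>
  from this[of u] this[of v] have "(u, a * u + b * v, v, c * u + d * v) \<in> carrier SL2 \<and>
     x \<otimes>\<^bsub>SL2\<^esub> (u, a * u + b * v, v, c * u + d * v) =
     (u, a * u + b * v, v, c * u + d * v) \<otimes>\<^bsub>SL2\<^esub> (0, - 1, 1, mat2_trace x)"
    using assms(2) by (simp add: carrier_SL2 mult_SL2 x algebra_simps)
  then show ?thesis using that by blast
qed

section \<open>Cyclic and abelian subgroups of SL(2,7)\<close>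

lemma f7_cases: "x = 0 \<or> x = 1 \<or> x = 2 \<or> x = 3 \<or> x = 4 \<or> x = 5 \<or> x = (6::7)"
proof (cases x rule: bit1_cases)
  case (of_int z)
  then have "z = 0 \<or> z = 1 \<or> z = 2 \<or> z = 3 \<or> z = 4 \<or> z = 5 \<or> z = 6" by auto
  then show ?thesis using of_int by auto
qed

text \<open>Quantified statements over the residues modulo 7 become finite checks.\<close>

lemma f7_all: "(\<forall>x::7. P x) \<longleftrightarrow> P 0 \<and> P 1 \<and> P 2 \<and> P 3 \<and> P 4 \<and> P 5 \<and> P 6"
  using f7_cases by metis

lemma f7_ex: "(\<exists>x::7. P x) \<longleftrightarrow> P 0 \<or> P 1 \<or> P 2 \<or> P 3 \<or> P 4 \<or> P 5 \<or> P 6"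
  using f7_cases by metis

lemma f7_inverse:
  fixes x :: 7
  assumes "x \<noteq> 0"
  obtains y where "x * y = 1"
proof -
  have "\<forall>x::7. x \<noteq> 0 \<longrightarrow> (\<exists>y. x * y = 1)" by (simp add: f7_all f7_ex)
  then show ?thesis using assms that by blast
qed

lemma f7_mult_eq_0: "x * y = 0 \<longleftrightarrow> x = 0 \<or> y = (0::7)"
proof -
  have "\<forall>x y::7. x * y = 0 \<longrightarrow> x = 0 \<or> y = 0" by (simp add: f7_all)
  then show ?thesis by auto
qed

lemma f7_mult_cancel: "x * y = x * z \<longleftrightarrow> x = 0 \<or> y = (z::7)"
  using f7_mult_eq_0[of x "y - z"] by (simp add: algebra_simps)

text \<open>A nonscalar \<open>x\<close> is linearly independent of the identity, so the
  coefficients of \<open>r + s x\<close> can be read off.\<close>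

lemma affine_eq_scalar_iff:
  fixes x :: "7 mat2"
  assumes "\<not> scalar x"
  shows "affine r s x = (q, 0, 0, q) \<longleftrightarrow> s = 0 \<and> r = q"
    and "scalar (affine r s x) \<longleftrightarrow> s = 0"
proof -
  obtain a b c d where x: "x = (a, b, c, d)" by (cases x)
  have "s = 0" if "affine r s x = (q, 0, 0, q)" for q
  proof (rule ccontr)
    assume "s \<noteq> 0"
    then have "a = d" "b = 0" "c = 0"
      using that f7_mult_cancel[of s a d] by (auto simp: x f7_mult_eq_0)
    then show False using assms by (auto simp: x scalar_def)
  qed
  then show "affine r s x = (q, 0, 0, q) \<longleftrightarrow> s = 0 \<and> r = q"
    and "scalar (affine r s x) \<longleftrightarrow> s = 0"
    by (auto simp: x scalar_def)
qed

section \<open>Binary quadratic forms modulo 7\<close>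

text \<open>Behind the enumeration is a count: \<open>a * (x * x)\<close> and
  \<open>1 - b * (y * y)\<close> take four values each among seven residues, so they meet.\<close>

lemma f7_binary_form: "\<forall>a b::7. a \<noteq> 0 \<and> b \<noteq> 0 \<longrightarrow> (\<exists>x y. a * (x * x) + b * (y * y) = 1)"
  by (simp add: f7_all f7_ex)

text \<open>Completing the square: \<open>4 * A\<close> times the form is the square of
  \<open>2 * A * u + B * v\<close> minus \<open>D * (v * v)\<close>. Dividing by
  \<open>4 * A\<close> leaves a diagonal form with nonzero coefficients, which represents 1.\<close>

lemma f7_quadratic_form_eq_1:
  fixes A B C :: 7
  assumes A: "A \<noteq> 0" and D: "B * B - 4 * (A * C) \<noteq> 0"
  obtains u v where "A * (u * u) + B * (u * v) + C * (v * v) = 1"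
proof -
  define D where "D = B * B - 4 * (A * C)"
  have "4 * A \<noteq> 0" "2 * A \<noteq> 0" using A by (simp_all add: f7_mult_eq_0)
  then obtain i j where i: "(4 * A) * i = 1" and j: "(2 * A) * j = 1"
    using f7_inverse by metis
  then have "i \<noteq> 0" by auto
  then have "i \<noteq> 0" "- (D * i) \<noteq> 0" using D by (auto simp: D_def f7_mult_eq_0)
  then obtain s v where sv: "i * (s * s) + - (D * i) * (v * v) = 1" using f7_binary_form by blast
  \<comment> \<open>Undoes the substitution \<open>s = 2 * A * u + B * v\<close>.\<close>
  define u where "u = j * (s - B * v)"
  have u: "2 * A * u + B * v = s"
    using j by (simp add: u_def flip: mult.assoc)
  have "(4 * A) * (A * (u * u) + B * (u * v) + C * (v * v)) =
      (2 * A * u + B * v) * (2 * A * u + B * v) - D * (v * v)"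
    by (simp add: D_def algebra_simps)
  also have "\<dots> = ((4 * A) * i) * (s * s - D * (v * v))"
    unfolding u i by simp
  also have "\<dots> = (4 * A) * (i * (s * s) + - (D * i) * (v * v))"
    by (simp add: algebra_simps)
  also have "\<dots> = (4 * A) * 1" by (simp only: sv)
  finally have "A * (u * u) + B * (u * v) + C * (v * v) = 1"
    unfolding f7_mult_cancel using \<open>4 * A \<noteq> 0\<close> by blast
  then show ?thesis by (rule that)
qed

text \<open>The discriminant of \<open>gen_form x\<close> is the square of the trace minus 4,
  nonzero here. If both outer coefficients vanish, the form is a nonzero multiple of
  \<open>u * v\<close>; otherwise the general result applies, with the variables swapped when
  \<open>b\<close> is used.\<close>

lemma gen_form_eq_1:
  fixes x :: "7 mat2"
  assumes x: "x \<in> carrier SL2" "\<not> scalar x" and t: "mat2_trace x * mat2_trace x \<noteq> 4"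
  obtains u v where "gen_form x u v = 1"
proof -
  obtain a b c d where x_eq: "x = (a, b, c, d)" by (cases x)
  have ad: "a * d = 1 + b * c" using x by (simp add: carrier_SL2 x_eq algebra_simps)
  have "(d - a) * (d - a) + 4 * (b * c) = (a + d) * (a + d) - 4 * (a * d) + 4 * (b * c)"
    by (simp add: algebra_simps)
  also have "\<dots> = (a + d) * (a + d) - 4" by (simp add: ad algebra_simps)
  finally have D: "(d - a) * (d - a) + 4 * (b * c) \<noteq> 0" using t by (simp add: x_eq)
  consider "c \<noteq> 0" | "- b \<noteq> 0" | "c = 0" "b = 0" by auto
  then show ?thesis
  proof cases
    case 1
    obtain u v where "c * (u * u) + (d - a) * (u * v) + (- b) * (v * v) = 1"
      using f7_quadratic_form_eq_1[OF 1, of "d - a" "- b"] D by (auto simp: mult.commute)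
    then show ?thesis using that[of u v] by (simp add: x_eq)
  next
    case 2
    obtain u v where "(- b) * (u * u) + (d - a) * (u * v) + c * (v * v) = 1"
      using f7_quadratic_form_eq_1[OF 2, of "d - a" c] D by auto
    then show ?thesis using that[of v u] by (simp add: x_eq algebra_simps)
  next
    case 3
    then have "a \<noteq> d" using x by (auto simp: scalar_def x_eq)
    then obtain z where "(d - a) * z = 1" using f7_inverse[of "d - a"] by auto
    then show ?thesis using 3 that[of z 1] by (simp add: x_eq)
  qed
qed

section \<open>Orders and conjugacy of cyclic subgroups in SL(2,7)\<close>

text \<open>Minimality ranges over an explicit list, so that it can be evaluated once
  \<open>n\<close> is a numeral.\<close>

lemma (in group) ord_eqI:
  assumes x: "x \<in> carrier G" and n: "x [^] n = \<one>" "0 < n"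
    and m: "\<forall>m\<in>set [1..<n]. x [^] m \<noteq> \<one>"
  shows "ord x = n"
proof -
  have "ord x dvd n" using pow_eq_id[OF x] n by blast
  then have "0 < ord x" "ord x \<le> n" using n by (auto intro: dvd_imp_le gr0I)
  moreover have "\<not> ord x < n" using m pow_ord_eq_1[OF x] \<open>0 < ord x\<close> by force
  ultimately show ?thesis by simp
qed

lemma finite_carrier_SL2: "finite (carrier (SL2 :: 'a::{comm_ring_1,finite} mat2 monoid))"
  by (rule finite_subset[OF subset_UNIV finite])

text \<open>By independence of 1 and \<open>x\<close> the coefficients decide; hence the order of a
  nonscalar element depends on its trace alone.\<close>

lemma SL2_pow_eq_scalar_iff:
  fixes x :: "7 mat2"
  assumes "x \<in> carrier SL2" "\<not> scalar x"
  shows "x [^]\<^bsub>SL2\<^esub> n = (q, 0, 0, q) \<longleftrightarrow> pow_coeffs (mat2_trace x) n = (q, 0)"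
    and "scalar (x [^]\<^bsub>SL2\<^esub> n) \<longleftrightarrow> snd (pow_coeffs (mat2_trace x) n) = 0"
  using assms by (cases "pow_coeffs (mat2_trace x) n"; simp add: SL2_pow affine_eq_scalar_iff; blast)+

lemma SL2_ordI:
  fixes x :: "7 mat2"
  assumes "x \<in> carrier SL2" "\<not> scalar x" "0 < n"
    and "pow_coeffs (mat2_trace x) n = (1, 0)"
    and "\<forall>m\<in>set [1..<n]. pow_coeffs (mat2_trace x) m \<noteq> (1, 0)"
  shows "SL2.ord x = n"
  using assms by (intro SL2.ord_eqI) (simp_all add: one_SL2 SL2_pow_eq_scalar_iff)

text \<open>The diagonal entry squares to 1, and 6 is -1 modulo 7.\<close>

lemma scalar_SL2_cases:
  fixes x :: "7 mat2"
  assumes "x \<in> carrier SL2" "scalar x"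
  shows "x = (1, 0, 0, 1) \<or> x = (6, 0, 0, 6)"
proof -
  have "\<forall>r::7. r * r = 1 \<longrightarrow> r = 1 \<or> r = 6" by (simp add: f7_all)
  then show ?thesis using assms by (auto simp: scalar_def carrier_SL2)
qed

text \<open>Each trace leaves a finite computation with \<open>pow_coeffs\<close>. Trace 2 is the
  unipotent case; trace 5, which is -2, is that of negated unipotent elements.\<close>

lemma SL2_ord:
  fixes x :: "7 mat2"
  assumes x: "x \<in> carrier SL2" "\<not> scalar x"
  shows "mat2_trace x = 0 \<Longrightarrow> SL2.ord x = 4"
    and "mat2_trace x = 1 \<Longrightarrow> SL2.ord x = 6"
    and "mat2_trace x = 2 \<Longrightarrow> SL2.ord x = 7"
    and "mat2_trace x = 3 \<Longrightarrow> SL2.ord x = 8"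
    and "mat2_trace x = 4 \<Longrightarrow> SL2.ord x = 8"
    and "mat2_trace x = 5 \<Longrightarrow> SL2.ord x = 14"
    and "mat2_trace x = 6 \<Longrightarrow> SL2.ord x = 3"
  by (rule SL2_ordI[OF x]; simp add: numeral_eq_Suc)+

text \<open>For trace 2 the polynomial is the square of X - 1, so X^n reduces to 1 + n (X -
  1).\<close>

lemma pow_coeffs_2: "pow_coeffs 2 n = (1 - of_nat n, of_nat n)"
  by (induction n) (simp_all add: algebra_simps)

lemma f7_of_nat: obtains n where "q = (of_nat n :: 7)"
proof (cases q rule: bit1_cases)
  case (of_int z)
  then show ?thesis using that[of "nat z"] by simp
qed

text \<open>For traces other than 2 and 5 the form represents 1, so \<open>x\<close> itself is
  conjugate to the companion matrix. For trace 2 the form is degenerate, and a power of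
  \<open>x\<close> generating the same subgroup rescales it. A nonscalar element of trace 5 has
  order 14.\<close>

lemma SL2_generate_conjugate_companion:
  fixes x :: "7 mat2"
  assumes x: "x \<in> carrier SL2" "\<not> scalar x" and t: "mat2_trace x \<noteq> 5"
  shows "conjugate_subgroups SL2 (generate SL2 {x}) (generate SL2 {(0, - 1, 1, mat2_trace x)})"
proof -
  obtain k m :: nat and u v where km: "(x [^]\<^bsub>SL2\<^esub> k) [^]\<^bsub>SL2\<^esub> m = x"
    and tr: "mat2_trace (x [^]\<^bsub>SL2\<^esub> k) = mat2_trace x"
    and form: "gen_form (x [^]\<^bsub>SL2\<^esub> k) u v = 1"
  proof (cases "mat2_trace x = 2")
    case True
    obtain u v where "gen_form x u v \<noteq> 0"
    proof -
      obtain a b c d where x_eq: "x = (a, b, c, d)" by (cases x)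
      \<comment> \<open>The values are \<open>c\<close>, \<open>- b\<close> and
        \<open>c + (d - a) - b\<close>; if all vanish, \<open>x\<close> is scalar.\<close>
      have "gen_form x 1 0 \<noteq> 0 \<or> gen_form x 0 1 \<noteq> 0 \<or> gen_form x 1 1 \<noteq> 0"
        using x(2) by (auto simp: x_eq scalar_def)
      then show ?thesis using that by blast
    qed
    moreover obtain m where m: "gen_form x u v = of_nat m" by (rule f7_of_nat)
    \<comment> \<open>The \<open>k\<close>-th power multiplies the form by \<open>k\<close>, so
      \<open>k\<close> is taken inverse to the value \<open>m\<close>; the \<open>m\<close>-th power
      then returns \<open>x\<close>.\<close>
    ultimately obtain k where k: "of_nat m * of_nat k = (1::7)"
      using f7_inverse f7_of_nat by metis
    have "(x [^]\<^bsub>SL2\<^esub> k) [^]\<^bsub>SL2\<^esub> m = affine (1 - of_nat m * of_nat k) (of_nat m * of_nat k) x"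
      unfolding SL2.nat_pow_pow[OF x(1)] using x True by (simp add: SL2_pow pow_coeffs_2 mult.commute)
    also have "\<dots> = x" unfolding k by (cases x) simp
    finally have "(x [^]\<^bsub>SL2\<^esub> k) [^]\<^bsub>SL2\<^esub> m = x" .
    moreover have "gen_form (x [^]\<^bsub>SL2\<^esub> k) u v = 1"
      using x True k m by (simp add: SL2_pow pow_coeffs_2 gen_form_affine mult.commute)
    moreover have "mat2_trace (x [^]\<^bsub>SL2\<^esub> k) = mat2_trace x"
      using x True by (simp add: SL2_pow pow_coeffs_2 mat2_trace_affine algebra_simps)
    ultimately show ?thesis using that by blast
  next
    case False
    have "\<forall>t::7. t \<noteq> 2 \<and> t \<noteq> 5 \<longrightarrow> t * t \<noteq> 4" by (simp add: f7_all)
    then obtain u v where "gen_form x u v = 1" using gen_form_eq_1[OF x] False t by metis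
    then show ?thesis using that[of 1 1 u v] x by simp
  qed
  from x have "x [^]\<^bsub>SL2\<^esub> k \<in> carrier SL2" by simp
  from SL2_companion[OF this form] obtain g where "g \<in> carrier SL2"
    "x [^]\<^bsub>SL2\<^esub> k \<otimes>\<^bsub>SL2\<^esub> g = g \<otimes>\<^bsub>SL2\<^esub> (0, - 1, 1, mat2_trace x)"
    unfolding tr by blast
  then show ?thesis
    using x km by (intro conjugate_generateI[OF group_SL2, of x _ g k m]) (auto simp: carrier_SL2)
qed

text \<open>An element of trace \<open>-3\<close> has order 8, and its fifth power is its negative, of trace 3.\<close>

lemma SL2_generate_conjugate_trace_4:
  fixes x :: "7 mat2"
  assumes x: "x \<in> carrier SL2" "\<not> scalar x" and t: "mat2_trace x = 4"
  shows "conjugate_subgroups SL2 (generate SL2 {x}) (generate SL2 {(0, - 1, 1, 3)})"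
proof -
  \<comment> \<open>The exponent 5 is its own inverse modulo the order 8, whence 25.\<close>
  have p: "pow_coeffs (4::7) 5 = (0, 6)" "pow_coeffs (4::7) 25 = (0, 1)"
    by (simp_all add: numeral_eq_Suc)
  have tr: "mat2_trace (x [^]\<^bsub>SL2\<^esub> (5::nat)) = 3"
    using x t by (simp add: SL2_pow p mat2_trace_affine)
  have x5: "x [^]\<^bsub>SL2\<^esub> (5::nat) \<in> carrier SL2" "\<not> scalar (x [^]\<^bsub>SL2\<^esub> (5::nat))"
    using x t by (simp, simp add: SL2_pow_eq_scalar_iff p)
  then obtain u v where "gen_form (x [^]\<^bsub>SL2\<^esub> (5::nat)) u v = 1"
    using gen_form_eq_1[of "x [^]\<^bsub>SL2\<^esub> (5::nat)"] unfolding tr by force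
  from SL2_companion[OF x5(1) this] obtain g where "g \<in> carrier SL2"
    "x [^]\<^bsub>SL2\<^esub> (5::nat) \<otimes>\<^bsub>SL2\<^esub> g = g \<otimes>\<^bsub>SL2\<^esub> (0, - 1, 1, 3)"
    unfolding tr by blast
  moreover have "(x [^]\<^bsub>SL2\<^esub> (5::nat)) [^]\<^bsub>SL2\<^esub> (5::nat) = x"
    unfolding SL2.nat_pow_pow[OF x(1)] using x t by (cases x) (simp add: SL2_pow p)
  ultimately show ?thesis
    using x by (intro conjugate_generateI[OF group_SL2, of x _ g 5 5]) (auto simp: carrier_SL2)
qed

text \<open>Serves to rule out the orders 6 and 14, each divisible by two primes.\<close>

lemma prime_power_prime_divisors_eq:
  fixes p :: nat
  assumes "prime p" "prime q" "prime r" "p ^ k = n" "q dvd n" "r dvd n"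
  shows "q = r"
  using assms by (metis prime_dvd_power primes_dvd_imp_eq)

lemma primes_3_7: "prime (3::nat)" "prime (7::nat)"
  by (simp_all add: prime_nat_iff' atLeastLessThan_nat_numeral)

text \<open>Every cyclic subgroup of the given order is conjugate to that of one chosen
  representative; order 8 unites the traces 3 and 4.\<close>

lemma SL2_generate_conjugate:
  fixes x y :: "7 mat2"
  assumes x: "x \<in> carrier SL2" and y: "y \<in> carrier SL2" and xy: "SL2.ord x = SL2.ord y"
    and prime_power: "prime (p::nat)" "SL2.ord x = p ^ k"
  shows "conjugate_subgroups SL2 (generate SL2 {x}) (generate SL2 {y})"
proof -
  \<comment> \<open>The identity and its negative for orders 1 and 2, companion matrices of traces
    6, 0, 2 and 3 for orders 3, 4, 7 and 8; the last default is meant for order 8.\<close>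
  define c :: "nat \<Rightarrow> 7 mat2" where "c n = (if n = 1 then (1, 0, 0, 1) else if n = 2 then (6, 0, 0, 6)
    else (0, - 1, 1, if n = 3 then 6 else if n = 4 then 0 else if n = 7 then 2 else 3))" for n
  have *: "conjugate_subgroups SL2 (generate SL2 {x}) (generate SL2 {c (p ^ k)})"
    if x: "x \<in> carrier SL2" and ord: "SL2.ord x = p ^ k" for x
  proof (cases "scalar x")
    case True
    have "SL2.ord (6, 0, 0, 6::7) = 2"
      by (rule SL2.ord_eqI) (simp_all add: carrier_SL2 one_SL2 mult_SL2 numeral_eq_Suc)
    moreover have "SL2.ord (1, 0, 0, 1::7) = 1"
      using SL2.ord_id by (simp add: one_SL2)
    ultimately have "x = c (p ^ k)"
      using scalar_SL2_cases[OF x True] ord by (auto simp: c_def)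
    then show ?thesis
      using x SL2.generate_incl[of "{x}"] by (simp add: conjugate_subgroups_refl[OF group_SL2])
  next
    case False
    have "p ^ k \<noteq> 6" "p ^ k \<noteq> 14"
      using prime_power_prime_divisors_eq[OF prime_power(1) two_is_prime_nat primes_3_7(1), of k 6]
        prime_power_prime_divisors_eq[OF prime_power(1) two_is_prime_nat primes_3_7(2), of k 14]
      by auto
    note ords = SL2_ord[OF x False, unfolded ord] this SL2_generate_conjugate_companion[OF x False]
      SL2_generate_conjugate_trace_4[OF x False]
    show ?thesis
      using f7_cases[of "mat2_trace x"] by (elim disjE) (use ords in \<open>simp_all add: c_def\<close>)
  qed
  have sub: "generate SL2 {x} \<subseteq> carrier SL2" "generate SL2 {y} \<subseteq> carrier SL2"
    using x y by (simp_all add: SL2.generate_incl)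
  have "conjugate_subgroups SL2 (generate SL2 {c (p ^ k)}) (generate SL2 {y})"
    using * y xy prime_power(2) by (intro conjugate_subgroups_sym[OF group_SL2 sub(2)]) simp
  from conjugate_subgroups_trans[OF group_SL2 sub(1) *[OF x prime_power(2)] this] show ?thesis .
qed

section \<open>Centralizers and abelian subgroups\<close>

text \<open>Commutation makes \<open>(f, g, e - h)\<close> proportional to
  \<open>(b, c, a - d)\<close>, a nonzero vector because \<open>x\<close> is not scalar. The factor
  \<open>s\<close> is found by dividing by a nonzero coordinate.\<close>

lemma commute_imp_affine:
  fixes x y :: "7 mat2"
  assumes "\<not> scalar x" and comm: "mat2_mult x y = mat2_mult y x"
  obtains r s where "y = affine r s x"
proof -
  obtain a b c d where x: "x = (a, b, c, d)" by (cases x)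
  obtain e f g h where y: "y = (e, f, g, h)" by (cases y)
  have eqs: "a * e + b * g = e * a + f * c" "a * f + b * h = e * b + f * d"
    "c * e + d * g = g * a + h * c"
    using comm by (simp_all only: x y mat2_mult.simps prod.inject)
  have bc: "b * g = c * f" using eqs(1) by (simp add: mult.commute)
  have "b * (e - h) - (a - d) * f = (e * b + f * d) - (a * f + b * h)" by (simp add: algebra_simps)
  then have b: "b * (e - h) = (a - d) * f" by (simp add: eqs)
  have "c * (e - h) - (a - d) * g = (c * e + d * g) - (g * a + h * c)" by (simp add: algebra_simps)
  then have c: "c * (e - h) = (a - d) * g" by (simp add: eqs)
  consider "b \<noteq> 0" | "c \<noteq> 0" | "a - d \<noteq> 0"
    using assms(1) by (auto simp: x scalar_def)
  then obtain s where "f = s * b" "g = s * c" "e - h = s * (a - d)"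
  proof cases
    case 1
    then obtain z where "b * z = 1" by (rule f7_inverse)
    then have w: "z * (b * w) = w" for w
      by (metis mult.assoc mult.commute mult_1_left)
    have "f = (z * f) * b" using w[of "f"] by (simp only: ac_simps)
    moreover
    have "g = (z * f) * c" using w[of "g"] unfolding bc by (simp only: ac_simps)
    moreover
    have "e - h = (z * f) * (a - d)" using w[of "e - h"] unfolding b by (simp only: ac_simps)
    ultimately show ?thesis by (rule that)
  next
    case 2
    then obtain z where "c * z = 1" by (rule f7_inverse)
    then have w: "z * (c * w) = w" for w
      by (metis mult.assoc mult.commute mult_1_left)
    have "f = (z * g) * b" using w[of "f"] unfolding bc[symmetric] by (simp only: ac_simps)
    moreover
    have "g = (z * g) * c" using w[of "g"] by (simp only: ac_simps)
    moreover
    have "e - h = (z * g) * (a - d)" using w[of "e - h"] unfolding c by (simp only: ac_simps)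
    ultimately show ?thesis by (rule that)
  next
    case 3
    then obtain z where "(a - d) * z = 1" by (rule f7_inverse)
    then have w: "z * ((a - d) * w) = w" for w
      by (metis mult.assoc mult.commute mult_1_left)
    have "f = (z * (e - h)) * b" using w[of "f"] unfolding b[symmetric] by (simp only: ac_simps)
    moreover
    have "g = (z * (e - h)) * c" using w[of "g"] unfolding c[symmetric] by (simp only: ac_simps)
    moreover
    have "e - h = (z * (e - h)) * (a - d)" using w[of "e - h"] by (simp only: ac_simps)
    ultimately show ?thesis by (rule that)
  qed
  then have "y = affine (e - s * a) s x"
    by (simp add: x y algebra_simps)
  then show ?thesis by (rule that)
qed

text \<open>For these traces X generates the group of norm 1 elements modulo X^2 - t X + 1. The
  polynomial splits for 1, is irreducible for 3 and has a double root for 5; the groups have 6, 8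
  and 14 elements, as the lists of powers confirm.\<close>

lemma norm_1_is_power:
  fixes r s t :: 7
  assumes t: "t \<in> {1, 3, 5}" and rs: "r * r + r * s * t + s * s = 1"
  obtains k where "pow_coeffs t k = (r, s)"
proof -
  have powers: "map (pow_coeffs (1::7)) [0..<6] = [(1,0),(0,1),(6,1),(6,0),(0,6),(1,6)]"
    "map (pow_coeffs (3::7)) [0..<8] = [(1,0),(0,1),(6,3),(4,1),(6,0),(0,6),(1,4),(3,6)]"
    "map (pow_coeffs (5::7)) [0..<14] = [(1,0),(0,1),(6,5),(2,3),(4,3),(4,5),(2,1),(6,0),(0,6),(1,2),(5,4),(3,4),(3,2),(5,6)]"
    by (simp_all add: numeral_eq_Suc)
  have "\<forall>r s::7. r * r + r * s * 1 + s * s = 1 \<longrightarrow> (r, s) \<in> set (map (pow_coeffs 1) [0..<6])"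
    "\<forall>r s::7. r * r + r * s * 3 + s * s = 1 \<longrightarrow> (r, s) \<in> set (map (pow_coeffs 3) [0..<8])"
    "\<forall>r s::7. r * r + r * s * 5 + s * s = 1 \<longrightarrow> (r, s) \<in> set (map (pow_coeffs 5) [0..<14])"
    unfolding powers by (simp_all add: f7_all)
  then have "\<exists>n. (r, s) \<in> set (map (pow_coeffs t) [0..<n])" using t rs by blast
  then show ?thesis using that by auto
qed

text \<open>The centralizer of a nonscalar matrix \<open>x\<close> consists of the elements of norm 1 in the ring
  generated by \<open>x\<close>; it is cyclic of order 6, 8 or 14, with a generator of trace 1, 3 or \<open>-2\<close>.\<close>

lemma SL2_abelian_subgroup_cyclic:
  fixes H :: "7 mat2 set"
  assumes H: "subgroup H SL2" and comm: "\<And>x y. \<lbrakk>x \<in> H; y \<in> H\<rbrakk> \<Longrightarrow> mat2_mult x y = mat2_mult y x"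
  obtains x where "x \<in> carrier SL2" "H = generate SL2 {x}"
proof -
  have carrier: "x \<in> carrier SL2" if "x \<in> H" for x
    using H that by (rule subgroup.mem_carrier)
  have "\<exists>y\<in>carrier SL2. H \<subseteq> generate SL2 {y}"
  proof (cases "\<forall>x\<in>H. scalar x")
    case True
    let ?y = "(6, 0, 0, 6) :: 7 mat2"
    have "?y \<in> carrier SL2" by (simp add: carrier_SL2)
    moreover have "x \<in> generate SL2 {?y}" if "x \<in> H" for x
    proof -
      have "x = (1, 0, 0, 1) \<or> x = ?y" using True that by (intro scalar_SL2_cases carrier) auto
      then show ?thesis
        using generate.one[of SL2 "{?y}"] generate.incl[of ?y "{?y}" SL2]
        by (elim disjE) (simp_all add: one_SL2)
    qed
    ultimately show ?thesis by blast
  next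
    case False
    then obtain x where x: "x \<in> H" "\<not> scalar x" by blast
    \<comment> \<open>The conditions make \<open>r + s x\<close> a nonscalar matrix of determinant 1
      whose trace is one for which the powers exhaust the norm 1 elements.\<close>
    have "\<exists>r s. s \<noteq> 0 \<and> r * r + r * s * mat2_trace x + s * s = 1 \<and> 2 * r + s * mat2_trace x \<in> {1, 3, 5}"
    proof -
      \<comment> \<open>For trace 0, \<open>5 + 2 x\<close> has norm 29 = 1 and trace 10 = 3; for
        traces 2, 4 and 6 it suffices to negate \<open>x\<close>.\<close>
      have "mat2_trace x = 0 \<Longrightarrow> ?thesis" by (intro exI[of _ 5] exI[of _ 2]) simp
      moreover have "mat2_trace x \<in> {1, 3, 5} \<Longrightarrow> ?thesis" by (intro exI[of _ 0] exI[of _ 1]) simp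
      moreover have "mat2_trace x \<in> {2, 4, 6} \<Longrightarrow> ?thesis" by (intro exI[of _ 0] exI[of _ 6]) auto
      ultimately show ?thesis using f7_cases[of "mat2_trace x"] by blast
    qed
    then obtain r s where rs: "s \<noteq> 0" "r * r + r * s * mat2_trace x + s * s = 1"
      "2 * r + s * mat2_trace x \<in> {1, 3, 5}" by blast
    define y where "y = affine r s x"
    have y: "y \<in> carrier SL2" "\<not> scalar y" "mat2_trace y \<in> {1, 3, 5}"
      using rs carrier[OF x(1)] x(2)
      by (simp_all only: y_def carrier_SL2 mat2_det_affine affine_eq_scalar_iff mat2_trace_affine not_False_eq_True)
    have "h \<in> generate SL2 {y}" if h: "h \<in> H" for h
    proof -
      \<comment> \<open>Both \<open>h\<close> and \<open>y\<close> lie in the ring generated by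
        \<open>x\<close>, so they commute and \<open>h\<close> can be rewritten in terms of
        \<open>y\<close>.\<close>
      obtain r' s' where "h = affine r' s' x"
        using commute_imp_affine[OF x(2)] comm[OF x(1) h] by blast
      then have "mat2_mult y h = mat2_mult h y" by (simp only: y_def affine_comm)
      then obtain u v where h_eq: "h = affine u v y" using commute_imp_affine[OF y(2)] by blast
      then have "u * u + u * v * mat2_trace y + v * v = 1"
        using carrier[OF h] y(1) by (simp add: carrier_SL2 mat2_det_affine)
      then obtain k where "pow_coeffs (mat2_trace y) k = (u, v)" by (rule norm_1_is_power[OF y(3)])
      then have "h = y [^]\<^bsub>SL2\<^esub> k" using y(1) by (simp add: SL2_pow h_eq)
      then show ?thesis using y(1) by (simp add: SL2.pow_in_generate)
    qed
    then show ?thesis using y(1) by blast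
  qed
  then obtain y n where "y \<in> carrier SL2" "H = generate SL2 {y [^]\<^bsub>SL2\<^esub> (n::nat)}"
    using SL2.subgroup_of_generate_singleton[OF finite_carrier_SL2 H] by metis
  then show ?thesis using that SL2.nat_pow_closed by blast
qed

lemma SL2_in_groups_with_conjugate_comm:
  "(SL2 :: 7 mat2 monoid) \<in> groups_with_conjugate comm_group"
proof -
  have *: "\<exists>x\<in>carrier SL2. H = generate SL2 {x} \<and> card H = SL2.ord x"
    if H: "subgroup H SL2" "comm_group (SL2\<lparr>carrier := H\<rparr>)" for H :: "7 mat2 set"
  proof -
    have "mat2_mult x y = mat2_mult y x" if "x \<in> H" "y \<in> H" for x y
      using comm_groupE(4)[OF H(2), of x y] that by (simp add: mult_SL2)
    from SL2_abelian_subgroup_cyclic[OF H(1) this] show ?thesis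
      by (metis SL2.generate_pow_card)
  qed
  have "conjugate_subgroups SL2 H K"
    if "subgroup H SL2" "comm_group (SL2\<lparr>carrier := H\<rparr>)"
      and "subgroup K SL2" "comm_group (SL2\<lparr>carrier := K\<rparr>)"
      and "card H = card K" "prime p" "card H = p ^ k" for H K :: "7 mat2 set" and p k :: nat
    using *[OF that(1,2)] *[OF that(3,4)] that(5-7) SL2_generate_conjugate by metis
  then show ?thesis
    unfolding groups_with_conjugate_def using group_SL2 finite_carrier_SL2 by blast
qed

section \<open>Conjugation invariants and the quaternion subgroup\<close>

lemma (in group) subgroup_comm_groupI:
  assumes "subgroup H G" "\<And>x y. \<lbrakk>x \<in> H; y \<in> H\<rbrakk> \<Longrightarrow> x \<otimes> y = y \<otimes> x"
  shows "comm_group (G\<lparr>carrier := H\<rparr>)"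
  using assms by (intro group.group_comm_groupI subgroup.subgroup_is_group is_group) auto

lemma (in group) generate_singleton_comm:
  assumes "x \<in> carrier G" "a \<in> generate G {x}" "b \<in> generate G {x}"
  shows "a \<otimes> b = b \<otimes> a"
proof -
  obtain i j :: int where "a = x [^] i" "b = x [^] j"
    using assms by (auto simp: generate_pow)
  then show ?thesis using assms(1) by (simp add: add.commute flip: int_pow_mult)
qed

text \<open>The invariant that separates the quaternion group from a cyclic group of order
  8.\<close>

lemma conjugate_subgroups_comm:
  assumes "group G" "H \<subseteq> carrier G" "conjugate_subgroups G H K"
    and comm: "\<And>x y. \<lbrakk>x \<in> H; y \<in> H\<rbrakk> \<Longrightarrow> x \<otimes>\<^bsub>G\<^esub> y = y \<otimes>\<^bsub>G\<^esub> x"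
    and "a \<in> K" "b \<in> K"
  shows "a \<otimes>\<^bsub>G\<^esub> b = b \<otimes>\<^bsub>G\<^esub> a"
proof -
  interpret group G by fact
  obtain g where g: "g \<in> carrier G" and K: "K = (\<lambda>h. g \<otimes>\<^bsub>G\<^esub> h \<otimes>\<^bsub>G\<^esub> inv\<^bsub>G\<^esub> g) ` H"
    using assms(3) by (auto simp: conjugate_subgroups_iff_image)
  interpret hom: group_hom G G "\<lambda>h. g \<otimes>\<^bsub>G\<^esub> h \<otimes>\<^bsub>G\<^esub> inv\<^bsub>G\<^esub> g"
    using g by (rule conjugation_hom)
  obtain x y where "x \<in> H" "y \<in> H" "a = g \<otimes>\<^bsub>G\<^esub> x \<otimes>\<^bsub>G\<^esub> inv\<^bsub>G\<^esub> g" "b = g \<otimes>\<^bsub>G\<^esub> y \<otimes>\<^bsub>G\<^esub> inv\<^bsub>G\<^esub> g"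
    using assms(5,6) K by blast
  then show ?thesis
    using comm[of x y] assms(2) hom.hom_mult[of x y] hom.hom_mult[of y x] by (simp add: subset_iff)
qed

text \<open>The invariant that separates the Klein four-group from a cyclic group of order
  4.\<close>

lemma conjugate_subgroups_pow_eq_one:
  fixes n :: nat
  assumes "group G" "H \<subseteq> carrier G" "conjugate_subgroups G H K"
    and pow: "\<And>x. x \<in> H \<Longrightarrow> x [^]\<^bsub>G\<^esub> n = \<one>\<^bsub>G\<^esub>" and "a \<in> K"
  shows "a [^]\<^bsub>G\<^esub> n = \<one>\<^bsub>G\<^esub>"
proof -
  interpret group G by fact
  obtain g where g: "g \<in> carrier G" and K: "K = (\<lambda>h. g \<otimes>\<^bsub>G\<^esub> h \<otimes>\<^bsub>G\<^esub> inv\<^bsub>G\<^esub> g) ` H"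
    using assms(3) by (auto simp: conjugate_subgroups_iff_image)
  interpret hom: group_hom G G "\<lambda>h. g \<otimes>\<^bsub>G\<^esub> h \<otimes>\<^bsub>G\<^esub> inv\<^bsub>G\<^esub> g"
    using g by (rule conjugation_hom)
  obtain x where "x \<in> H" "a = g \<otimes>\<^bsub>G\<^esub> x \<otimes>\<^bsub>G\<^esub> inv\<^bsub>G\<^esub> g"
    using assms(5) K by blast
  then show ?thesis
    using pow[of x] assms(2) hom.hom_nat_pow[of x n] g by (simp add: subset_iff)
qed

text \<open>A weaker condition on subgroups demands conjugacy of more pairs, so the class
  shrinks.\<close>

lemma groups_with_conjugate_antimono:
  assumes "\<And>A. \<lbrakk>group A; P A\<rbrakk> \<Longrightarrow> P' A"
  shows "groups_with_conjugate P' \<subseteq> groups_with_conjugate P"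
  using assms subgroup.subgroup_is_group unfolding groups_with_conjugate_def by blast

lemma groups_with_conjugateD:
  assumes "G \<in> groups_with_conjugate P" "subgroup H G" "subgroup K G"
    "P (G\<lparr>carrier := H\<rparr>)" "P (G\<lparr>carrier := K\<rparr>)" "card H = p ^ k" "card K = p ^ k" "prime (p::nat)"
  shows "conjugate_subgroups G H K"
proof -
  have "card H = card K \<and> (\<exists>(p::nat) k. prime p \<and> card H = p ^ k)"
    using assms(6-8) by (intro conjI exI[of _ p] exI[of _ k]) simp_all
  then show ?thesis
    using assms(1-5) unfolding groups_with_conjugate_def by blast
qed

text \<open>The elements are \<open>1, -1, i, -i, j, -j, k, -k\<close>, where \<open>j\<close> comes from \<open>2\<^sup>2 + 3\<^sup>2 = -1\<close>
  modulo 7.\<close>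

definition quaternion_group :: "7 mat2 set" where
  "quaternion_group = {(1, 0, 0, 1), (6, 0, 0, 6), (0, 6, 1, 0), (0, 1, 6, 0),
     (2, 3, 3, 5), (5, 4, 4, 2), (4, 2, 2, 3), (3, 5, 5, 4)}"

definition center_SL2 :: "7 mat2 set" where
  "center_SL2 = {(1, 0, 0, 1), (6, 0, 0, 6)}"

lemma center_SL2_iff: "z \<in> center_SL2 \<longleftrightarrow> z \<in> carrier SL2 \<and> scalar z"
  using scalar_SL2_cases[of z] by (auto simp: center_SL2_def carrier_SL2 scalar_def)

lemma center_SL2_commute: "z \<in> center_SL2 \<Longrightarrow> mat2_mult z x = mat2_mult x z"
  by (cases x) (auto simp: center_SL2_def mult.commute)

lemma subgroup_SL2I:
  fixes H :: "7 mat2 set"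
  assumes "(1, 0, 0, 1) \<in> H" "\<forall>x\<in>H. mat2_det x = 1"
    and "\<forall>x\<in>H. \<forall>y\<in>H. mat2_mult x y \<in> H"
    and "\<forall>x\<in>H. \<exists>y\<in>H. mat2_mult y x = (1, 0, 0, 1)"
  shows "subgroup H SL2"
proof (rule SL2.subgroupI)
  fix x assume "x \<in> H"
  then obtain y where "y \<in> H" "mat2_mult y x = (1, 0, 0, 1)" using assms(4) by blast
  then have "inv\<^bsub>SL2\<^esub> x = y"
    using assms(2) \<open>x \<in> H\<close> by (intro SL2.inv_equality) (auto simp: carrier_SL2 one_SL2 mult_SL2)
  then show "inv\<^bsub>SL2\<^esub> x \<in> H" using \<open>y \<in> H\<close> by simp
qed (use assms in \<open>auto simp: carrier_SL2 mult_SL2\<close>)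

lemma subgroup_quaternion_group: "subgroup quaternion_group SL2"
  by (rule subgroup_SL2I) (simp_all add: quaternion_group_def)

lemma subgroup_center_SL2: "subgroup center_SL2 SL2"
  by (rule subgroup_SL2I) (simp_all add: center_SL2_def)

text \<open>Commutators are plus or minus 1. This yields nilpotency in \<open>SL2\<close> and
  commutativity in the quotient.\<close>

lemma quaternion_group_commute:
  assumes "x \<in> quaternion_group" "y \<in> quaternion_group"
  shows "\<exists>z\<in>center_SL2. mat2_mult x y = mat2_mult z (mat2_mult y x)"
proof -
  have "\<forall>x\<in>quaternion_group. \<forall>y\<in>quaternion_group. \<exists>z\<in>center_SL2.
      mat2_mult x y = mat2_mult z (mat2_mult y x)"
    by (simp add: quaternion_group_def center_SL2_def)
  then show ?thesis using assms by blast
qed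

lemma nilpotent_quaternion_group: "nilpotent_group (SL2\<lparr>carrier := quaternion_group\<rparr>)"
proof (rule nilpotent_groupI)
  let ?Q = "SL2\<lparr>carrier := quaternion_group\<rparr>"
  show "group ?Q"
    using subgroup_quaternion_group group_SL2 by (rule subgroup.subgroup_is_group)
  have "center_SL2 \<subseteq> quaternion_group" by (simp add: center_SL2_def quaternion_group_def)
  then show "subgroup center_SL2 ?Q"
    by (intro SL2.subgroup_incl subgroup_center_SL2 subgroup_quaternion_group)
  show "z \<otimes>\<^bsub>?Q\<^esub> y = y \<otimes>\<^bsub>?Q\<^esub> z" if "z \<in> center_SL2" for z y
    using center_SL2_commute[OF that] by (simp add: mult_SL2)
  fix x y assume "x \<in> carrier ?Q" "y \<in> carrier ?Q"
  then have xy: "x \<in> quaternion_group" "y \<in> quaternion_group" by simp_all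
  then have c: "x \<in> carrier SL2" "y \<in> carrier SL2"
    using subgroup.mem_carrier[OF subgroup_quaternion_group] by blast+
  obtain z where z: "z \<in> center_SL2" "x \<otimes>\<^bsub>SL2\<^esub> y = z \<otimes>\<^bsub>SL2\<^esub> (y \<otimes>\<^bsub>SL2\<^esub> x)"
    using quaternion_group_commute[OF xy] by (auto simp: mult_SL2)
  then have "x \<otimes>\<^bsub>SL2\<^esub> y \<otimes>\<^bsub>SL2\<^esub> inv\<^bsub>SL2\<^esub> x \<otimes>\<^bsub>SL2\<^esub> inv\<^bsub>SL2\<^esub> y = z"
    using c by (simp add: SL2.m_assoc center_SL2_iff)
  then show "x \<otimes>\<^bsub>?Q\<^esub> y \<otimes>\<^bsub>?Q\<^esub> inv\<^bsub>?Q\<^esub> x \<otimes>\<^bsub>?Q\<^esub> inv\<^bsub>?Q\<^esub> y \<in> center_SL2"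
    using xy z(1) by (simp add: SL2.m_inv_consistent[OF subgroup_quaternion_group])
qed

text \<open>A cyclic group and the quaternion group are both nilpotent of order 8, but only the
  first is abelian.\<close>

lemma SL2_not_in_groups_with_conjugate_nilpotent:
  "(SL2 :: 7 mat2 monoid) \<notin> groups_with_conjugate nilpotent_group"
proof
  assume *: "(SL2 :: 7 mat2 monoid) \<in> groups_with_conjugate nilpotent_group"
  \<comment> \<open>The companion matrix of trace 3, with 6 for -1; it has order 8.\<close>
  define c :: "7 mat2" where "c = (0, 6, 1, 3)"
  let ?C = "generate SL2 {c}"
  have c: "c \<in> carrier SL2" "\<not> scalar c" by (simp_all add: c_def carrier_SL2 scalar_def)
  have C: "subgroup ?C SL2" using c by (intro SL2.generate_is_subgroup) simp
  have conj: "conjugate_subgroups SL2 ?C quaternion_group"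
  proof (rule groups_with_conjugateD[OF * C subgroup_quaternion_group])
    show "nilpotent_group (SL2\<lparr>carrier := ?C\<rparr>)"
      by (intro comm_group_imp_nilpotent SL2.subgroup_comm_groupI C SL2.generate_singleton_comm[OF c(1)])
    show "card ?C = 2 ^ 3"
      using SL2_ord(4)[OF c] SL2.generate_pow_card[OF c(1)] by (simp add: c_def)
    show "card quaternion_group = 2 ^ 3" by (simp add: quaternion_group_def)
  qed (simp_all add: nilpotent_quaternion_group)
  have "mat2_mult a b = mat2_mult b a" if "a \<in> quaternion_group" "b \<in> quaternion_group" for a b
    using conjugate_subgroups_comm[OF group_SL2 subgroup.subset[OF C] conj _ that]
      SL2.generate_singleton_comm[OF c(1)] by (simp add: mult_SL2)
  \<comment> \<open>The elements i and j, which anticommute.\<close>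
  from this[of "(0, 6, 1, 0)" "(2, 3, 3, 5)"] show False
    by (simp add: quaternion_group_def)
qed

section \<open>The group PSL(2,7)\<close>

abbreviation PSL2_7 :: "7 mat2 set monoid" where
  "PSL2_7 \<equiv> SL2 Mod center_SL2"

abbreviation proj :: "7 mat2 \<Rightarrow> 7 mat2 set" where
  "proj x \<equiv> center_SL2 #>\<^bsub>SL2\<^esub> x"

lemma normal_center_SL2: "center_SL2 \<lhd> SL2"
proof (rule SL2.normal_invI[OF subgroup_center_SL2])
  fix x z :: "7 mat2" assume "x \<in> carrier SL2" and z: "z \<in> center_SL2"
  then have "x \<otimes>\<^bsub>SL2\<^esub> z \<otimes>\<^bsub>SL2\<^esub> inv\<^bsub>SL2\<^esub> x = z"
    using center_SL2_commute[OF z, of "inv\<^bsub>SL2\<^esub> x"] z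
    by (simp add: SL2.m_assoc SL2.inv_cancel_left center_SL2_iff flip: mult_SL2)
  then show "x \<otimes>\<^bsub>SL2\<^esub> z \<otimes>\<^bsub>SL2\<^esub> inv\<^bsub>SL2\<^esub> x \<in> center_SL2" using z by simp
qed

lemma group_PSL2_7: "group PSL2_7"
  using normal_center_SL2 by (rule normal.factorgroup_is_group)

interpretation PSL: group PSL2_7
  by (rule group_PSL2_7)

interpretation proj: group_hom SL2 PSL2_7 proj
  using normal.r_coset_hom_Mod[OF normal_center_SL2] by unfold_locales

lemma carrier_PSL2_7: "carrier PSL2_7 = proj ` carrier SL2"
  by (auto simp: FactGroup_def RCOSETS_def)

lemma finite_carrier_PSL2_7: "finite (carrier PSL2_7)"
  unfolding carrier_PSL2_7 using finite_carrier_SL2 by (rule finite_imageI)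

lemma proj_eq: "proj x = {x, mat2_mult (6, 0, 0, 6) x}"
  by (cases x) (auto simp: r_coset_def center_SL2_def mult_SL2)

lemma proj_eq_one_iff:
  assumes "x \<in> carrier SL2"
  shows "proj x = \<one>\<^bsub>PSL2_7\<^esub> \<longleftrightarrow> scalar x"
  using SL2.coset_join1[OF _ assms subgroup_center_SL2] SL2.coset_join2[OF assms subgroup_center_SL2]
    assms center_SL2_iff[of x] by auto

text \<open>The scalar matrix 6 is minus the identity and lies in the centre. Hence the sign of a
  lift can be chosen freely.\<close>

lemma proj_uminus: "proj (mat2_mult (6, 0, 0, 6) x) = proj x"
proof -
  have "6 * (6 * a) = a" for a :: 7
  proof -
    have "6 * (6 * a) = (6 * 6) * a" by (simp only: mult.assoc)
    also have "(6::7) * 6 = 1" by simp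
    finally show ?thesis by simp
  qed
  then show ?thesis by (cases x) (simp only: proj_eq mat2_mult.simps mult_zero_left add_0_left add_0_right insert_commute)
qed

text \<open>A power of the image is trivial exactly when that power of \<open>x\<close> is scalar,
  so only the second coefficient matters.\<close>

lemma PSL2_7_ordI:
  assumes x: "x \<in> carrier SL2" "\<not> scalar x" "0 < n"
    and "snd (pow_coeffs (mat2_trace x) n) = 0"
    and "\<forall>m\<in>set [1..<n]. snd (pow_coeffs (mat2_trace x) m) \<noteq> 0"
  shows "PSL.ord (proj x) = n"
proof -
  have "proj x [^]\<^bsub>PSL2_7\<^esub> m = \<one>\<^bsub>PSL2_7\<^esub> \<longleftrightarrow> snd (pow_coeffs (mat2_trace x) m) = 0" for m :: nat
    using x proj_eq_one_iff[of "x [^]\<^bsub>SL2\<^esub> m"]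
    by (simp add: SL2_pow_eq_scalar_iff proj.hom_nat_pow del: one_FactGroup)
  then show ?thesis
    using assms by (intro PSL.ord_eqI proj.hom_closed) (simp_all del: one_FactGroup)
qed

text \<open>Changing the sign of a lift negates its trace, so these four traces suffice for all
  nonscalar elements.\<close>

lemma PSL2_7_ord:
  assumes x: "x \<in> carrier SL2" "\<not> scalar x"
  shows "mat2_trace x = 0 \<Longrightarrow> PSL.ord (proj x) = 2"
    and "mat2_trace x = 2 \<Longrightarrow> PSL.ord (proj x) = 7"
    and "mat2_trace x = 3 \<Longrightarrow> PSL.ord (proj x) = 4"
    and "mat2_trace x = 6 \<Longrightarrow> PSL.ord (proj x) = 3"
  by (rule PSL2_7_ordI[OF x]; simp add: numeral_eq_Suc)+

text \<open>A nonscalar lift is chosen, up to sign, with trace 0, 2, 3 or 6, which avoids trace 5.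
  Its cyclic subgroup is conjugate to that of a companion matrix, and the quotient map carries this
  conjugacy to \<open>PSL2_7\<close>.\<close>

lemma PSL2_7_generate_conjugate:
  assumes p: "p \<in> carrier PSL2_7" and q: "q \<in> carrier PSL2_7" and ord: "PSL.ord p = PSL.ord q"
  shows "conjugate_subgroups PSL2_7 (generate PSL2_7 {p}) (generate PSL2_7 {q})"
proof -
  \<comment> \<open>Representatives for orders 1, 2, 3, 4 and 7; the default trace 2 is meant for
    order 7.\<close>
  define c :: "nat \<Rightarrow> 7 mat2" where "c n = (if n = 1 then (1, 0, 0, 1)
    else (0, - 1, 1, if n = 2 then 0 else if n = 3 then 6 else if n = 4 then 3 else 2))" for n
  have *: "conjugate_subgroups PSL2_7 (generate PSL2_7 {p}) (generate PSL2_7 {proj (c (PSL.ord p))})"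
    if p: "p \<in> carrier PSL2_7" for p
  proof -
    obtain x where x: "x \<in> carrier SL2" "p = proj x" using p by (auto simp: carrier_PSL2_7)
    show ?thesis
    proof (cases "scalar x")
      case True
      then have "p = \<one>\<^bsub>PSL2_7\<^esub>" using x proj_eq_one_iff by blast
      moreover have "proj (1, 0, 0, 1) = \<one>\<^bsub>PSL2_7\<^esub>"
        using proj.hom_one by (simp only: one_SL2)
      moreover have "PSL.ord \<one>\<^bsub>PSL2_7\<^esub> = 1" by (rule PSL.ord_id)
      ultimately have "p = proj (c (PSL.ord p))" by (simp only: c_def simp_thms if_True)
      moreover have "generate PSL2_7 {p} \<subseteq> carrier PSL2_7" using p by (intro PSL.generate_incl) simp
      ultimately show ?thesis using conjugate_subgroups_refl[OF group_PSL2_7] by metis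
    next
      case False
      obtain y where y: "y \<in> carrier SL2" "\<not> scalar y" "p = proj y" "mat2_trace y \<in> {0, 2, 3, 6}"
      proof (cases "mat2_trace x \<in> {0, 2, 3, 6}")
        case True
        then show ?thesis using that x False by blast
      next
        case tr: False
        let ?y = "mat2_mult (6, 0, 0, 6) x"
        have y: "?y = affine 0 6 x" by (cases x) simp
        \<comment> \<open>Negation turns the traces 1, 4 and 5 into 6, 3 and 2.\<close>
        have "mat2_trace ?y \<in> {0, 2, 3, 6}"
          using tr f7_cases[of "mat2_trace x"] by (auto simp: y mat2_trace_affine)
        moreover have "?y \<in> carrier SL2" "\<not> scalar ?y"
          using x(1) False by (simp_all add: y carrier_SL2 mat2_det_affine affine_eq_scalar_iff)
        ultimately show ?thesis using that x(2) proj_uminus by metis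
      qed
      have "c (PSL.ord p) = (0, - 1, 1, mat2_trace y)"
        using y(4) PSL2_7_ord[OF y(1,2)] by (auto simp: c_def y(3))
      moreover have "conjugate_subgroups SL2 (generate SL2 {y}) (generate SL2 {(0, - 1, 1, mat2_trace y)})"
        using y by (intro SL2_generate_conjugate_companion) auto
      ultimately have "conjugate_subgroups PSL2_7 (proj ` generate SL2 {y}) (proj ` generate SL2 {c (PSL.ord p)})"
        using y(1) by (intro conjugate_subgroups_hom_image[OF proj.group_hom_axioms] SL2.generate_incl) simp_all
      moreover have "c (PSL.ord p) \<in> carrier SL2" by (simp add: c_def carrier_SL2)
      ultimately show ?thesis
        using y(1,3) proj.generate_img[of "{y}"] proj.generate_img[of "{c (PSL.ord p)}"] by simp
    qed
  qed
  have sub: "generate PSL2_7 {p} \<subseteq> carrier PSL2_7" "generate PSL2_7 {q} \<subseteq> carrier PSL2_7"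
    using p q by (simp_all only: PSL.generate_incl insert_subset empty_subsetI)
  have "conjugate_subgroups PSL2_7 (generate PSL2_7 {proj (c (PSL.ord p))}) (generate PSL2_7 {q})"
    unfolding ord using *[OF q] by (rule conjugate_subgroups_sym[OF group_PSL2_7 sub(2)])
  from conjugate_subgroups_trans[OF group_PSL2_7 sub(1) *[OF p] this] show ?thesis .
qed

lemma PSL2_7_in_groups_with_conjugate_cyclic: "PSL2_7 \<in> groups_with_conjugate cyclic_group"
proof -
  have *: "\<exists>p\<in>carrier PSL2_7. H = generate PSL2_7 {p} \<and> card H = PSL.ord p"
    if H: "subgroup H PSL2_7" "cyclic_group (PSL2_7\<lparr>carrier := H\<rparr>)" for H
  proof -
    obtain p where p: "p \<in> H" "subgroup_generated (PSL2_7\<lparr>carrier := H\<rparr>) {p} = PSL2_7\<lparr>carrier := H\<rparr>"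
      using H(2) by (auto simp: cyclic_group_def)
    from arg_cong[OF p(2), of carrier] p(1) have "generate (PSL2_7\<lparr>carrier := H\<rparr>) {p} = H"
      by (simp add: carrier_subgroup_generated)
    then have "H = generate PSL2_7 {p}"
      using PSL.generate_consistent[OF _ H(1), of "{p}"] p(1) by simp
    moreover have "p \<in> carrier PSL2_7" using H(1) p(1) by (rule subgroup.mem_carrier)
    ultimately show ?thesis using PSL.generate_pow_card by metis
  qed
  have "conjugate_subgroups PSL2_7 H K"
    if H: "subgroup H PSL2_7" "cyclic_group (PSL2_7\<lparr>carrier := H\<rparr>)"
      and K: "subgroup K PSL2_7" "cyclic_group (PSL2_7\<lparr>carrier := K\<rparr>)" and "card H = card K" for H K
    using *[OF H] *[OF K] \<open>card H = card K\<close> PSL2_7_generate_conjugate by metis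
  then show ?thesis
    unfolding groups_with_conjugate_def using group_PSL2_7 finite_carrier_PSL2_7 by blast
qed

text \<open>Commutators and squares of the quaternion group lie in the centre, so they become
  trivial in the quotient.\<close>

lemma proj_quaternion_group:
  assumes "a \<in> proj ` quaternion_group" "b \<in> proj ` quaternion_group"
  shows "a \<otimes>\<^bsub>PSL2_7\<^esub> b = b \<otimes>\<^bsub>PSL2_7\<^esub> a" "a [^]\<^bsub>PSL2_7\<^esub> (2::nat) = \<one>\<^bsub>PSL2_7\<^esub>"
proof -
  have Q: "x \<in> carrier SL2" if "x \<in> quaternion_group" for x
    using subgroup_quaternion_group that by (rule subgroup.mem_carrier)
  obtain x y where x: "x \<in> quaternion_group" "a = proj x" and y: "y \<in> quaternion_group" "b = proj y"
    using assms by blast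
  obtain z where z: "z \<in> center_SL2" "x \<otimes>\<^bsub>SL2\<^esub> y = z \<otimes>\<^bsub>SL2\<^esub> (y \<otimes>\<^bsub>SL2\<^esub> x)"
    using quaternion_group_commute[OF x(1) y(1)] by (auto simp: mult_SL2)
  then have "proj z = \<one>\<^bsub>PSL2_7\<^esub>" "z \<in> carrier SL2"
    using center_SL2_iff proj_eq_one_iff by blast+
  then have "proj (x \<otimes>\<^bsub>SL2\<^esub> y) = proj (y \<otimes>\<^bsub>SL2\<^esub> x)"
    unfolding z(2) using Q[OF x(1)] Q[OF y(1)] by (simp del: one_FactGroup mult_FactGroup)
  then show "a \<otimes>\<^bsub>PSL2_7\<^esub> b = b \<otimes>\<^bsub>PSL2_7\<^esub> a"
    using Q[OF x(1)] Q[OF y(1)] by (simp add: x y del: one_FactGroup mult_FactGroup)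
  have "\<forall>x\<in>quaternion_group. mat2_mult x x \<in> center_SL2"
    by (simp add: quaternion_group_def center_SL2_def)
  moreover have "x [^]\<^bsub>SL2\<^esub> (2::nat) = mat2_mult x x"
    using Q[OF x(1)] by (simp add: numeral_2_eq_2 flip: mult_SL2)
  ultimately have "x [^]\<^bsub>SL2\<^esub> (2::nat) \<in> center_SL2" using x(1) by simp
  then have "proj (x [^]\<^bsub>SL2\<^esub> (2::nat)) = \<one>\<^bsub>PSL2_7\<^esub>"
    using center_SL2_iff proj_eq_one_iff by blast
  then show "a [^]\<^bsub>PSL2_7\<^esub> (2::nat) = \<one>\<^bsub>PSL2_7\<^esub>"
    using Q[OF x(1)] by (simp add: x proj.hom_nat_pow del: one_FactGroup mult_FactGroup)
qed

text \<open>Of two abelian subgroups of order 4, the Klein four-group has trivial squares and the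
  cyclic one does not.\<close>

lemma PSL2_7_not_in_groups_with_conjugate_comm: "PSL2_7 \<notin> groups_with_conjugate comm_group"
proof
  assume *: "PSL2_7 \<in> groups_with_conjugate comm_group"
  \<comment> \<open>The matrix of trace 3 has order 8 in \<open>SL2\<close> and order 4 in the
    quotient.\<close>
  define c :: "7 mat2" where "c = (0, 6, 1, 3)"
  let ?C = "generate PSL2_7 {proj c}" and ?V = "proj ` quaternion_group"
  have c: "c \<in> carrier SL2" "\<not> scalar c" by (simp_all add: c_def carrier_SL2 scalar_def)
  then have pc: "proj c \<in> carrier PSL2_7" by simp
  have ord: "PSL.ord (proj c) = 4" using PSL2_7_ord(3)[OF c] by (simp add: c_def)
  have C: "subgroup ?C PSL2_7" using pc by (intro PSL.generate_is_subgroup) simp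
  have V: "subgroup ?V PSL2_7"
    using subgroup_quaternion_group by (rule proj.subgroup_img_is_subgroup)
  have conj: "conjugate_subgroups PSL2_7 ?V ?C"
  proof (rule groups_with_conjugateD[OF * V C])
    show "comm_group (PSL2_7\<lparr>carrier := ?C\<rparr>)"
      by (intro PSL.subgroup_comm_groupI C PSL.generate_singleton_comm[OF pc])
    show "comm_group (PSL2_7\<lparr>carrier := ?V\<rparr>)"
      by (intro PSL.subgroup_comm_groupI V proj_quaternion_group(1))
    show "card ?C = 2 ^ 2" using ord PSL.generate_pow_card[OF pc] by simp
    \<comment> \<open>Eight matrices form four cosets, each a pair of opposite matrices.\<close>
    show "card ?V = 2 ^ 2"
      by (simp add: quaternion_group_def proj_eq card_insert_if doubleton_eq_iff)
  qed simp
  have "proj c \<in> ?C" by (intro generate.incl) simp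
  then have "proj c [^]\<^bsub>PSL2_7\<^esub> (2::nat) = \<one>\<^bsub>PSL2_7\<^esub>"
    using conjugate_subgroups_pow_eq_one[OF group_PSL2_7 subgroup.subset[OF V] conj] proj_quaternion_group(2)
    by blast
  then have "4 dvd (2::nat)" using PSL.pow_eq_id[OF pc] ord by metis
  then show False by simp
qed

section \<open>Strictness over the natural numbers\<close>

text \<open>An isomorphic copy over \<open>nat\<close> inherits membership in the first class, and
  its membership in the second would transfer back to \<open>G\<close>. Each property appears at two
  types, hence the equivalences.\<close>

lemma separating_nat_group:
  fixes G :: "'b monoid"
  assumes "G \<in> groups_with_conjugate P" "G \<notin> groups_with_conjugate P'"
    and P: "\<And>(A :: 'b monoid) (B :: nat monoid). \<lbrakk>group A; group B; A \<cong> B\<rbrakk> \<Longrightarrow> P A \<longleftrightarrow> R B"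
    and P': "\<And>(A :: 'b monoid) (B :: nat monoid). \<lbrakk>group A; group B; A \<cong> B\<rbrakk> \<Longrightarrow> P' A \<longleftrightarrow> R' B"
  shows "\<exists>N. N \<in> groups_with_conjugate R \<and> N \<notin> groups_with_conjugate R'"
proof -
  have G: "group G" "finite (carrier G)" using assms(1) by (auto simp: groups_with_conjugate_def)
  obtain N :: "nat monoid" and f where N: "group N" and f: "f \<in> iso G N"
    using ex_nat_group_iso[OF G] by blast
  have "N \<in> groups_with_conjugate R"
    using P by (intro groups_with_conjugate_iso[OF assms(1) N f]) blast
  moreover have "G \<in> groups_with_conjugate P'" if "N \<in> groups_with_conjugate R'"
    using P' group.iso_sym
    by (intro groups_with_conjugate_iso[OF that G(1) group.iso_set_sym[OF G(1) f]]) blast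
  ultimately show ?thesis using assms(2) by blast
qed

lemma N_pi_subset_A_pi: "N_pi \<subseteq> A_pi"
  unfolding N_pi_def A_pi_def
  by (intro groups_with_conjugate_antimono comm_group_imp_nilpotent)

lemma A_pi_subset_C_pi: "A_pi \<subseteq> C_pi"
  unfolding A_pi_def C_pi_def
  by (intro groups_with_conjugate_antimono group.cyclic_imp_abelian_group)

theorem mainTheorem7:
  shows "(N_pi :: 'a monoid set) \<subseteq> A_pi \<and> (A_pi :: 'a monoid set) \<subseteq> C_pi \<and>
         (N_pi :: nat monoid set) \<subset> A_pi \<and> (A_pi :: nat monoid set) \<subset> C_pi"
proof -
  have "\<exists>N :: nat monoid. N \<in> A_pi \<and> N \<notin> N_pi"
    unfolding N_pi_def A_pi_def
    by (rule separating_nat_group[OF SL2_in_groups_with_conjugate_comm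
          SL2_not_in_groups_with_conjugate_nilpotent iso_comm_group iso_nilpotent_group])
  moreover have "\<exists>N :: nat monoid. N \<in> C_pi \<and> N \<notin> A_pi"
    unfolding A_pi_def C_pi_def
    by (rule separating_nat_group[OF PSL2_7_in_groups_with_conjugate_cyclic
          PSL2_7_not_in_groups_with_conjugate_comm isomorphic_group_cyclicity iso_comm_group])
  ultimately show ?thesis
    by (intro conjI psubsetI N_pi_subset_A_pi A_pi_subset_C_pi) auto
qed

end
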